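(* Let $T:\mathbf{X}\to\mathbf{B}^{op}$ be a functor, where $\mathbf{X}$ is a category and $\mathbf{B}$ is a variety of algebras, such that there exists an adjoint situation $(\eta,\varepsilon):T\dashv Pt:\mathbf{B}^{op}\to\mathbf{X}$ (with unit $\eta$ and counit $\varepsilon$). Then: (1) There exists a functor $ILoc:\mathbf{AfInst}(T)\to\mathbf{LAfInst}(T)$, defined on a morphism $(\Phi,\alpha):(\mathbf{S}_1,I_1)\to(\mathbf{S}_2,I_2)$ by $ILoc(\Phi,\alpha)=(\Phi,Loc\,\alpha):(\mathbf{S}_1,Loc\,I_1)\to(\mathbf{S}_2,Loc\,I_2)$. (2) There exists a full embedding $IE:\mathbf{LAfInst}(T)\hookrightarrow\mathbf{AfInst}(T)$, given on a morphism $(\Phi,\alpha):(\mathbf{S}_1,I_1)\to(\mathbf{S}_2,I_2)$ by $IE(\Phi,\alpha)=(\Phi,E\alpha):(\mathbf{S}_1,EI_1)\to(\mathbf{S}_2,EI_2)$, such that $ILoc$ is a left-adjoint-left-inverse to $IE$. (3) $\mathbf{LAfInst}(T)$ is isomorphic to a full reflective subcategory of $\mathbf{AfInst}(T)$.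
   Context: **Algebras and varieties.** Let $\Omega=(n_\lambda)_{\lambda\in\Lambda}$ be a family of cardinal numbers indexed by a (possibly proper or empty) class $\Lambda$. An $\Omega$-algebra is a set $A$ with maps $\omega^A_\lambda:A^{n_\lambda}\to A$ ($\lambda\in\Lambda$); an $\Omega$-homomorphism is a map $\varphi:A\to B$ with $\varphi\circ\omega^A_\lambda=\omega^B_\lambda\circ\varphi^{n_\lambda}$ for every $\lambda\in\Lambda$. A variety of algebras $\mathbf{B}$ is a full subcategory of the category of $\Omega$-algebras and $\Omega$-homomorphisms (for some $\Omega$) that is closed under products, subalgebras and homomorphic images. $\mathbf{B}^{op}$ is the opposite category. No distinction is made between categories and quasicategories (i.e. size issues are ignored: objects need not form a class and hom-families need not be sets). **$T$-systems.** $\mathbf{Af\,Sys}(T)$ is the comma category $(T\downarrow 1_{\mathbf{B}^{op}})$: its objects are triples $(X,\kappa,B)$ with $X$ an object of $\mathbf{X}$, $B$ an object of $\mathbf{B}^{op}$ and $\kappa:TX\to B$ a morphism of $\mathbf{B}^{op}$; its morphisms $(X_1,\kappa_1,B_1)\to(X_2,\kappa_2,B_2)$ are pairs $(f,\varphi)$, $f:X_1\to X_2$ in $\mathbf{X}$, $\varphi:B_1\to B_2$ in $\mathbf{B}^{op}$, with $\kappa_2\circ Tf=\varphi\circ\kappa_1$. **The functors $Loc$ and $E$.** $Loc:\mathbf{Af\,Sys}(T)\to\mathbf{B}^{op}$ sends $(f,\varphi):(X_1,\kappa_1,B_1)\to(X_2,\kappa_2,B_2)$ to $\varphi:B_1\to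 B_2$. Given the adjoint situation $(\eta,\varepsilon):T\dashv Pt$, the functor $E:\mathbf{B}^{op}\to\mathbf{Af\,Sys}(T)$ sends $\varphi:B_1\to B_2$ to $(Pt\,\varphi,\varphi):(Pt\,B_1,\varepsilon_{B_1},B_1)\to(Pt\,B_2,\varepsilon_{B_2},B_2)$. **Institutions.** $\mathbf{AfInst}(T)$ (affine institutions over $T$) is the category whose objects are pairs $(\mathbf{S},I)$ consisting of a category $\mathbf{S}$ (of abstract signatures) and a functor $I:\mathbf{S}\to\mathbf{Af\,Sys}(T)$; a morphism $(\mathbf{S}_1,I_1)\to(\mathbf{S}_2,I_2)$ is a pair $(\Phi,\alpha)$ with $\Phi:\mathbf{S}_1\to\mathbf{S}_2$ a functor and $\alpha:I_1\to I_2\Phi$ a natural transformation. Composition is $(\Phi',\alpha')\circ(\Phi,\alpha)=(\Phi'\Phi,\ \alpha'\Phi\circ\alpha)$, and identities are the evident ones. $\mathbf{LAfInst}(T)$ (localic affine $T$-institutions) is defined in exactly the same way with $\mathbf{Af\,Sys}(T)$ replaced by $\mathbf{B}^{op}$. **Terminology.** A full embedding is a functor that is full, faithful and injective on objects. A functor $G$ is a left-adjoint-left-inverse to a functor $F$ if $G$ is a left adjoint of $F$ and $GF=1$. $E\alpha$, $Loc\,\alpha$ denote whiskering of natural transformations with functors. *)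

theory Defs
  imports "HOL-Library.FuncSet"
begin

section \<open>Categories, functors, natural transformations\<close>

text \<open>
  No size condition is imposed on categories. \<open>Comp C g f\<close> is the composite "g after f".
  All structure maps are required to take the value \<open>undefined\<close> outside their proper domains, so
  that equality in HOL of categories, of functors and of natural transformations is mathematical
  equality. This matters because categories and functors occur below as objects of other categories.
\<close>

record ('o, 'a) cat =
  Obj :: "'o set"
  Arr :: "'a set"
  Dom :: "'a \<Rightarrow> 'o"
  Cod :: "'a \<Rightarrow> 'o"
  Ident :: "'o \<Rightarrow> 'a"
  Comp :: "'a \<Rightarrow> 'a \<Rightarrow> 'a"

definition hom :: "('o, 'a) cat \<Rightarrow> 'o \<Rightarrow> 'o \<Rightarrow> 'a set" where
  "hom C A B = {f \<in> Arr C. Dom C f = A \<and> Cod C f = B}"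

definition composable :: "('o, 'a) cat \<Rightarrow> 'a \<Rightarrow> 'a \<Rightarrow> bool" where
  "composable C g f \<longleftrightarrow> f \<in> Arr C \<and> g \<in> Arr C \<and> Cod C f = Dom C g"

definition category :: "('o, 'a) cat \<Rightarrow> bool" where
  "category C \<longleftrightarrow>
     Dom C \<in> Arr C \<rightarrow>\<^sub>E Obj C \<and>
     Cod C \<in> Arr C \<rightarrow>\<^sub>E Obj C \<and>
     Ident C \<in> extensional (Obj C) \<and>
     (\<forall>A \<in> Obj C. Ident C A \<in> hom C A A) \<and>
     (\<forall>f g. \<not> composable C g f \<longrightarrow> Comp C g f = undefined) \<and>
     (\<forall>f g. composable C g f \<longrightarrow> Comp C g f \<in> hom C (Dom C f) (Cod C g)) \<and>
     (\<forall>f \<in> Arr C. Comp C f (Ident C (Dom C f)) = f \<and> Comp C (Ident C (Cod C f)) f = f) \<and>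
     (\<forall>f g h. composable C g f \<and> composable C h g \<longrightarrow>
        Comp C h (Comp C g f) = Comp C (Comp C h g) f)"

definition op_cat :: "('o, 'a) cat \<Rightarrow> ('o, 'a) cat" where
  "op_cat C = \<lparr>Obj = Obj C, Arr = Arr C, Dom = Cod C, Cod = Dom C, Ident = Ident C,
               Comp = (\<lambda>g f. Comp C f g)\<rparr>"

record ('o, 'a, 'p, 'b) func =
  FObj :: "'o \<Rightarrow> 'p"
  FArr :: "'a \<Rightarrow> 'b"

definition is_functor ::
  "('o, 'a) cat \<Rightarrow> ('p, 'b) cat \<Rightarrow> ('o, 'a, 'p, 'b) func \<Rightarrow> bool" where
  "is_functor C D F \<longleftrightarrow>
     category C \<and> category D \<and>
     FObj F \<in> Obj C \<rightarrow>\<^sub>E Obj D \<and>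
     FArr F \<in> Arr C \<rightarrow>\<^sub>E Arr D \<and>
     (\<forall>f \<in> Arr C. Dom D (FArr F f) = FObj F (Dom C f) \<and> Cod D (FArr F f) = FObj F (Cod C f)) \<and>
     (\<forall>A \<in> Obj C. FArr F (Ident C A) = Ident D (FObj F A)) \<and>
     (\<forall>f g. composable C g f \<longrightarrow> FArr F (Comp C g f) = Comp D (FArr F g) (FArr F f))"

definition id_func :: "('o, 'a) cat \<Rightarrow> ('o, 'a, 'o, 'a) func" where
  "id_func C = \<lparr>FObj = (\<lambda>A \<in> Obj C. A), FArr = (\<lambda>f \<in> Arr C. f)\<rparr>"

text \<open>\<open>func_comp C G F\<close> is the composite "G after F", where \<open>C\<close> is the domain of \<open>F\<close>.\<close>

definition func_comp ::
  "('o, 'a) cat \<Rightarrow> ('p, 'b, 'q, 'c) func \<Rightarrow> ('o, 'a, 'p, 'b) func \<Rightarrow> ('o, 'a, 'q, 'c) func" where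
  "func_comp C G F =
     \<lparr>FObj = compose (Obj C) (FObj G) (FObj F), FArr = compose (Arr C) (FArr G) (FArr F)\<rparr>"

definition nat_trans ::
  "('o, 'a) cat \<Rightarrow> ('p, 'b) cat \<Rightarrow> ('o, 'a, 'p, 'b) func \<Rightarrow> ('o, 'a, 'p, 'b) func
     \<Rightarrow> ('o \<Rightarrow> 'b) \<Rightarrow> bool" where
  "nat_trans C D F G \<alpha> \<longleftrightarrow>
     is_functor C D F \<and> is_functor C D G \<and>
     \<alpha> \<in> extensional (Obj C) \<and>
     (\<forall>A \<in> Obj C. \<alpha> A \<in> hom D (FObj F A) (FObj G A)) \<and>
     (\<forall>f \<in> Arr C. Comp D (FArr G f) (\<alpha> (Dom C f)) = Comp D (\<alpha> (Cod C f)) (FArr F f))"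

definition vert_comp ::
  "('o, 'a) cat \<Rightarrow> ('p, 'b) cat \<Rightarrow> ('o \<Rightarrow> 'b) \<Rightarrow> ('o \<Rightarrow> 'b) \<Rightarrow> ('o \<Rightarrow> 'b)" where
  "vert_comp C D \<beta> \<alpha> = (\<lambda>A \<in> Obj C. Comp D (\<beta> A) (\<alpha> A))"

text \<open>The whiskerings \<open>H \<alpha>\<close> and \<open>\<alpha> F\<close>; in both cases \<open>C\<close> is the domain category of the result.\<close>

definition whisker_left ::
  "('o, 'a) cat \<Rightarrow> ('p, 'b, 'q, 'c) func \<Rightarrow> ('o \<Rightarrow> 'b) \<Rightarrow> ('o \<Rightarrow> 'c)" where
  "whisker_left C H \<alpha> = (\<lambda>A \<in> Obj C. FArr H (\<alpha> A))"

definition whisker_right ::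
  "('o, 'a) cat \<Rightarrow> ('p \<Rightarrow> 'c) \<Rightarrow> ('o, 'a, 'p, 'b) func \<Rightarrow> ('o \<Rightarrow> 'c)" where
  "whisker_right C \<alpha> F = (\<lambda>A \<in> Obj C. \<alpha> (FObj F A))"

text \<open>\<open>adjoint_situation X A F G \<eta> \<epsilon>\<close>: the functor \<open>F : X \<rightarrow> A\<close> is left adjoint to
  \<open>G : A \<rightarrow> X\<close> with unit \<open>\<eta>\<close> and counit \<open>\<epsilon>\<close>.\<close>

definition adjoint_situation ::
  "('o, 'a) cat \<Rightarrow> ('p, 'b) cat \<Rightarrow> ('o, 'a, 'p, 'b) func \<Rightarrow> ('p, 'b, 'o, 'a) func
     \<Rightarrow> ('o \<Rightarrow> 'a) \<Rightarrow> ('p \<Rightarrow> 'b) \<Rightarrow> bool" where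
  "adjoint_situation X A F G \<eta> \<epsilon> \<longleftrightarrow>
     is_functor X A F \<and> is_functor A X G \<and>
     nat_trans X X (id_func X) (func_comp X G F) \<eta> \<and>
     nat_trans A A (func_comp A F G) (id_func A) \<epsilon> \<and>
     (\<forall>x \<in> Obj X. Comp A (\<epsilon> (FObj F x)) (FArr F (\<eta> x)) = Ident A (FObj F x)) \<and>
     (\<forall>a \<in> Obj A. Comp X (FArr G (\<epsilon> a)) (\<eta> (FObj G a)) = Ident X (FObj G a))"

definition left_adjoint_left_inverse ::
  "('o, 'a) cat \<Rightarrow> ('p, 'b) cat \<Rightarrow> ('o, 'a, 'p, 'b) func \<Rightarrow> ('p, 'b, 'o, 'a) func \<Rightarrow> bool" where
  "left_adjoint_left_inverse X A G F \<longleftrightarrow>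
     (\<exists>\<eta> \<epsilon>. adjoint_situation X A G F \<eta> \<epsilon>) \<and> func_comp A G F = id_func A"

definition full_embedding ::
  "('o, 'a) cat \<Rightarrow> ('p, 'b) cat \<Rightarrow> ('o, 'a, 'p, 'b) func \<Rightarrow> bool" where
  "full_embedding C D F \<longleftrightarrow>
     is_functor C D F \<and>
     (\<forall>A \<in> Obj C. \<forall>B \<in> Obj C. FArr F ` hom C A B = hom D (FObj F A) (FObj F B)) \<and>
     (\<forall>A \<in> Obj C. \<forall>B \<in> Obj C. inj_on (FArr F) (hom C A B)) \<and>
     inj_on (FObj F) (Obj C)"

definition isomorphic_cats :: "('o, 'a) cat \<Rightarrow> ('p, 'b) cat \<Rightarrow> bool" where
  "isomorphic_cats C D \<longleftrightarrow>
     (\<exists>F G. is_functor C D F \<and> is_functor D C G \<and>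
            func_comp C G F = id_func C \<and> func_comp D F G = id_func D)"

definition full_subcategory :: "('o, 'a) cat \<Rightarrow> ('o, 'a) cat \<Rightarrow> bool" where
  "full_subcategory D C \<longleftrightarrow>
     category C \<and> category D \<and>
     Obj D \<subseteq> Obj C \<and> Arr D \<subseteq> Arr C \<and>
     (\<forall>f \<in> Arr D. Dom D f = Dom C f \<and> Cod D f = Cod C f) \<and>
     (\<forall>A \<in> Obj D. Ident D A = Ident C A) \<and>
     (\<forall>f g. composable D g f \<longrightarrow> Comp D g f = Comp C g f) \<and>
     (\<forall>A \<in> Obj D. \<forall>B \<in> Obj D. hom D A B = hom C A B)"

definition reflection_arrow ::
  "('o, 'a) cat \<Rightarrow> ('o, 'a) cat \<Rightarrow> 'o \<Rightarrow> 'o \<Rightarrow> 'a \<Rightarrow> bool" where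
  "reflection_arrow D C A A' r \<longleftrightarrow>
     A' \<in> Obj D \<and> r \<in> hom C A A' \<and>
     (\<forall>B \<in> Obj D. \<forall>f \<in> hom C A B. \<exists>!g. g \<in> hom D A' B \<and> f = Comp C g r)"

definition full_reflective_subcategory :: "('o, 'a) cat \<Rightarrow> ('o, 'a) cat \<Rightarrow> bool" where
  "full_reflective_subcategory D C \<longleftrightarrow>
     full_subcategory D C \<and> (\<forall>A \<in> Obj C. \<exists>A' r. reflection_arrow D C A A' r)"

text \<open>
  Concrete categories are built from families of hom-sets \<open>H A B\<close>, which need not be disjoint. An
  arrow is therefore a label tagged with its source and target. The first argument of the
  composition \<open>c\<close> on labels is the source of the composite.
\<close>

datatype ('o, 'm) arrow = Arrow (Src: 'o) (Lab: 'm) (Tgt: 'o)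

definition hom_arrows :: "'o set \<Rightarrow> ('o \<Rightarrow> 'o \<Rightarrow> 'm set) \<Rightarrow> ('o, 'm) arrow set" where
  "hom_arrows Ob H = {Arrow A m B | A m B. A \<in> Ob \<and> B \<in> Ob \<and> m \<in> H A B}"

definition hom_cat ::
  "'o set \<Rightarrow> ('o \<Rightarrow> 'o \<Rightarrow> 'm set) \<Rightarrow> ('o \<Rightarrow> 'm) \<Rightarrow> ('o \<Rightarrow> 'm \<Rightarrow> 'm \<Rightarrow> 'm)
     \<Rightarrow> ('o, ('o, 'm) arrow) cat" where
  "hom_cat Ob H i c =
     \<lparr>Obj = Ob,
      Arr = hom_arrows Ob H,
      Dom = restrict Src (hom_arrows Ob H),
      Cod = restrict Tgt (hom_arrows Ob H),
      Ident = (\<lambda>A \<in> Ob. Arrow A (i A) A),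
      Comp = (\<lambda>g f. if f \<in> hom_arrows Ob H \<and> g \<in> hom_arrows Ob H \<and> Tgt f = Src g
                     then Arrow (Src f) (c (Src f) (Lab g) (Lab f)) (Tgt g) else undefined)\<rparr>"


section \<open>Algebras and varieties\<close>

text \<open>
  A signature is a (possibly empty) set \<open>\<Lambda>\<close> of operation symbols together with a map \<open>ar\<close>; the
  cardinal \<open>n\<^sub>\<lambda>\<close> is represented by the (arbitrary, possibly infinite) set \<open>ar \<lambda>\<close>, so that the power
  of \<open>A\<close> to the exponent \<open>n\<^sub>\<lambda>\<close> is the function set \<open>ar \<lambda> \<rightarrow>\<^sub>E A\<close>. Algebras may be empty.
\<close>

record ('x, 'l, 'n) alg =
  Carrier :: "'x set"
  Op :: "'l \<Rightarrow> ('n \<Rightarrow> 'x) \<Rightarrow> 'x"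

definition omega_algebra :: "'l set \<Rightarrow> ('l \<Rightarrow> 'n set) \<Rightarrow> ('x, 'l, 'n) alg \<Rightarrow> bool" where
  "omega_algebra \<Lambda> ar A \<longleftrightarrow> Op A \<in> (\<Pi>\<^sub>E l \<in> \<Lambda>. (ar l \<rightarrow>\<^sub>E Carrier A) \<rightarrow>\<^sub>E Carrier A)"

definition alg_hom ::
  "'l set \<Rightarrow> ('l \<Rightarrow> 'n set) \<Rightarrow> ('x, 'l, 'n) alg \<Rightarrow> ('y, 'l, 'n) alg \<Rightarrow> ('x \<Rightarrow> 'y) set" where
  "alg_hom \<Lambda> ar A B =
     {\<phi> \<in> Carrier A \<rightarrow>\<^sub>E Carrier B.
        \<forall>l \<in> \<Lambda>. \<forall>x \<in> ar l \<rightarrow>\<^sub>E Carrier A. \<phi> (Op A l x) = Op B l (\<lambda>i \<in> ar l. \<phi> (x i))}"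

definition alg_cat ::
  "'l set \<Rightarrow> ('l \<Rightarrow> 'n set) \<Rightarrow> (('x, 'l, 'n) alg, (('x, 'l, 'n) alg, 'x \<Rightarrow> 'x) arrow) cat" where
  "alg_cat \<Lambda> ar =
     hom_cat {A. omega_algebra \<Lambda> ar A} (alg_hom \<Lambda> ar)
       (\<lambda>A. \<lambda>x \<in> Carrier A. x) (\<lambda>A \<psi> \<phi>. compose (Carrier A) \<psi> \<phi>)"

definition subalgebra ::
  "'l set \<Rightarrow> ('l \<Rightarrow> 'n set) \<Rightarrow> ('x, 'l, 'n) alg \<Rightarrow> ('x, 'l, 'n) alg \<Rightarrow> bool" where
  "subalgebra \<Lambda> ar S A \<longleftrightarrow>
     omega_algebra \<Lambda> ar S \<and> Carrier S \<subseteq> Carrier A \<and>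
     (\<forall>l \<in> \<Lambda>. \<forall>x \<in> ar l \<rightarrow>\<^sub>E Carrier S. Op S l x = Op A l x)"

definition homomorphic_image ::
  "'l set \<Rightarrow> ('l \<Rightarrow> 'n set) \<Rightarrow> ('x, 'l, 'n) alg \<Rightarrow> ('x, 'l, 'n) alg \<Rightarrow> bool" where
  "homomorphic_image \<Lambda> ar B A \<longleftrightarrow>
     omega_algebra \<Lambda> ar B \<and> (\<exists>\<phi> \<in> alg_hom \<Lambda> ar A B. \<phi> ` Carrier A = Carrier B)"

definition product_alg ::
  "'l set \<Rightarrow> ('l \<Rightarrow> 'n set) \<Rightarrow> 'i set \<Rightarrow> ('i \<Rightarrow> ('x, 'l, 'n) alg) \<Rightarrow> ('i \<Rightarrow> 'x, 'l, 'n) alg" where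
  "product_alg \<Lambda> ar I A =
     \<lparr>Carrier = (\<Pi>\<^sub>E i \<in> I. Carrier (A i)),
      Op = (\<lambda>l \<in> \<Lambda>. \<lambda>x \<in> ar l \<rightarrow>\<^sub>E (\<Pi>\<^sub>E i \<in> I. Carrier (A i)).
              \<lambda>i \<in> I. Op (A i) l (\<lambda>k \<in> ar l. x k i))\<rparr>"

definition is_product ::
  "'l set \<Rightarrow> ('l \<Rightarrow> 'n set) \<Rightarrow> ('x, 'l, 'n) alg \<Rightarrow> 'i set \<Rightarrow> ('i \<Rightarrow> ('x, 'l, 'n) alg) \<Rightarrow> bool" where
  "is_product \<Lambda> ar P I A \<longleftrightarrow>
     omega_algebra \<Lambda> ar P \<and>
     (\<exists>h \<in> alg_hom \<Lambda> ar P (product_alg \<Lambda> ar I A).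
        bij_betw h (Carrier P) (Carrier (product_alg \<Lambda> ar I A)))"

text \<open>
  The concrete product has its carrier in the type \<open>'i \<Rightarrow> 'x\<close>, so closure under products refers to
  the algebras over \<open>'x\<close> isomorphic to it. Taking index sets in \<open>'x\<close> loses nothing: if such an
  algebra \<open>P\<close> over \<open>'x\<close> is nonempty, the factors with at most one element can be dropped, and
  varying one coordinate at a time embeds the remaining index set into the carrier of \<open>P\<close>; if \<open>P\<close>
  is empty, it is a subalgebra of a factor. The empty product is included.
\<close>

definition variety ::
  "'l set \<Rightarrow> ('l \<Rightarrow> 'n set) \<Rightarrow> (('x, 'l, 'n) alg, (('x, 'l, 'n) alg, 'x \<Rightarrow> 'x) arrow) cat \<Rightarrow> bool"
  where
  "variety \<Lambda> ar B \<longleftrightarrow>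
     full_subcategory B (alg_cat \<Lambda> ar) \<and>
     (\<forall>(I :: 'x set) A P. (\<forall>i \<in> I. A i \<in> Obj B) \<and> is_product \<Lambda> ar P I A \<longrightarrow> P \<in> Obj B) \<and>
     (\<forall>A \<in> Obj B. \<forall>S. subalgebra \<Lambda> ar S A \<longrightarrow> S \<in> Obj B) \<and>
     (\<forall>A \<in> Obj B. \<forall>Q. homomorphic_image \<Lambda> ar Q A \<longrightarrow> Q \<in> Obj B)"


section \<open>Affine systems\<close>

text \<open>The comma category of a functor \<open>T : X \<rightarrow> D\<close> and the identity functor on \<open>D\<close>.\<close>

type_synonym ('xo, 'xa, 'do, 'da) sys_cat =
  "('xo \<times> 'da \<times> 'do, ('xo \<times> 'da \<times> 'do, 'xa \<times> 'da) arrow) cat"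

definition AfSys ::
  "('xo, 'xa) cat \<Rightarrow> ('do, 'da) cat \<Rightarrow> ('xo, 'xa, 'do, 'da) func \<Rightarrow> ('xo, 'xa, 'do, 'da) sys_cat"
  where
  "AfSys X D T =
     hom_cat {(x, \<kappa>, b). x \<in> Obj X \<and> b \<in> Obj D \<and> \<kappa> \<in> hom D (FObj T x) b}
       (\<lambda>(x1, \<kappa>1, b1) (x2, \<kappa>2, b2).
          {(f, \<phi>). f \<in> hom X x1 x2 \<and> \<phi> \<in> hom D b1 b2 \<and> Comp D \<kappa>2 (FArr T f) = Comp D \<phi> \<kappa>1})
       (\<lambda>(x, \<kappa>, b). (Ident X x, Ident D b))
       (\<lambda>_ (f', \<phi>') (f, \<phi>). (Comp X f' f, Comp D \<phi>' \<phi>))"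

definition Loc_func ::
  "('xo, 'xa) cat \<Rightarrow> ('do, 'da) cat \<Rightarrow> ('xo, 'xa, 'do, 'da) func \<Rightarrow>
     ('xo \<times> 'da \<times> 'do, ('xo \<times> 'da \<times> 'do, 'xa \<times> 'da) arrow, 'do, 'da) func" where
  "Loc_func X D T =
     \<lparr>FObj = (\<lambda>(x, \<kappa>, b) \<in> Obj (AfSys X D T). b),
      FArr = (\<lambda>m \<in> Arr (AfSys X D T). snd (Lab m))\<rparr>"

definition E_func ::
  "('do, 'da) cat \<Rightarrow> ('do, 'da, 'xo, 'xa) func \<Rightarrow> ('do \<Rightarrow> 'da) \<Rightarrow>
     ('do, 'da, 'xo \<times> 'da \<times> 'do, ('xo \<times> 'da \<times> 'do, 'xa \<times> 'da) arrow) func" where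
  "E_func D Pt \<epsilon> =
     \<lparr>FObj = (\<lambda>b \<in> Obj D. (FObj Pt b, \<epsilon> b, b)),
      FArr = (\<lambda>\<phi> \<in> Arr D.
        Arrow (FObj Pt (Dom D \<phi>), \<epsilon> (Dom D \<phi>), Dom D \<phi>)
              (FArr Pt \<phi>, \<phi>)
              (FObj Pt (Cod D \<phi>), \<epsilon> (Cod D \<phi>), Cod D \<phi>))\<rparr>"


section \<open>Institutions\<close>

text \<open>
  The category of pairs \<open>(S, I)\<close> of a category \<open>S\<close>, with objects in \<open>'so\<close> and arrows in \<open>'sa\<close>, and a
  functor \<open>I : S \<rightarrow> D\<close>. Affine and localic institutions are the two instances used.
\<close>

type_synonym ('so, 'sa, 'do, 'da) inst = "('so, 'sa) cat \<times> ('so, 'sa, 'do, 'da) func"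

type_synonym ('so, 'sa, 'da) inst_label = "('so, 'sa, 'so, 'sa) func \<times> ('so \<Rightarrow> 'da)"

type_synonym ('so, 'sa, 'do, 'da) inst_cat =
  "(('so, 'sa, 'do, 'da) inst, (('so, 'sa, 'do, 'da) inst, ('so, 'sa, 'da) inst_label) arrow) cat"

definition Inst :: "('do, 'da) cat \<Rightarrow> ('so, 'sa, 'do, 'da) inst_cat" where
  "Inst D =
     hom_cat {(S, I). category S \<and> is_functor S D I}
       (\<lambda>(S1, I1) (S2, I2).
          {(\<Phi>, \<alpha>). is_functor S1 S2 \<Phi> \<and> nat_trans S1 D I1 (func_comp S1 I2 \<Phi>) \<alpha>})
       (\<lambda>(S, I). (id_func S, \<lambda>s \<in> Obj S. Ident D (FObj I s)))
       (\<lambda>(S1, I1) (\<Phi>', \<alpha>') (\<Phi>, \<alpha>).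
          (func_comp S1 \<Phi>' \<Phi>, vert_comp S1 D (whisker_right S1 \<alpha>' \<Phi>) \<alpha>))"

definition AfInst ::
  "('xo, 'xa) cat \<Rightarrow> ('bo, 'ba) cat \<Rightarrow> ('xo, 'xa, 'bo, 'ba) func \<Rightarrow>
     ('so, 'sa, 'xo \<times> 'ba \<times> 'bo, ('xo \<times> 'ba \<times> 'bo, 'xa \<times> 'ba) arrow) inst_cat" where
  "AfInst X B T = Inst (AfSys X (op_cat B) T)"

definition LAfInst :: "('bo, 'ba) cat \<Rightarrow> ('so, 'sa, 'bo, 'ba) inst_cat" where
  "LAfInst B = Inst (op_cat B)"

end

theory Submission
  imports Defs
begin

text \<open>
  The functors \<open>ILoc\<close> and \<open>IE\<close> arise by applying one construction to \<open>Loc\<close> and \<open>E\<close>, namely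
  postcomposition of institutions with a functor. So the theorem splits into a statement about
  systems and a transport principle.
  
  On systems, \<open>Loc\<close> is left adjoint to \<open>E\<close>, with \<open>Loc E = 1\<close> and identity counit. The unit at
  \<open>(x, \<kappa>, b)\<close> is the pair of the transpose \<open>x \<rightarrow> Pt b\<close> of \<open>\<kappa>\<close> and the identity of \<open>b\<close>. It is a system
  morphism, and \<open>E\<close> is full, because a morphism \<open>f : x \<rightarrow> Pt b\<close> and its transpose \<open>\<epsilon>\<^sub>b \<circ> T f\<close> determine
  each other: the commuting square of a system morphism into \<open>E b\<close> expresses its first component
  in terms of the second (\<open>full_embedding_E_func\<close>, \<open>adjoint_situation_Loc_E\<close>).
  
  For the transport, \<open>Inst\<close> acts strictly 2-functorially on its base category: functors act by
  postcomposition and natural transformations by whiskering (\<open>functor_Inst_func\<close>, \<open>Inst_func_id\<close>,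
  \<open>Inst_func_comp\<close>, \<open>nat_trans_Inst_nat\<close>). It therefore preserves adjunctions and the equation
  \<open>Loc E = 1\<close> (\<open>adjoint_situation_Inst\<close>), and it preserves full embeddings because a
  transformation between functors landing in a full subcategory is one in that subcategory
  (\<open>full_embedding_Inst_func\<close>). The last claim of the theorem is the general fact that the image of
  a full embedding with a left adjoint is a reflective subcategory isomorphic to its source.
\<close>

section \<open>Categories, functors and natural transformations\<close>

text \<open>
  Membership in a hom-set records domain and codomain together, so composability of arrows is read
  off from matching objects. The laws are therefore restated along hom-sets.
\<close>

lemma hom_iff: "f \<in> hom C A B \<longleftrightarrow> f \<in> Arr C \<and> Dom C f = A \<and> Cod C f = B"
  by (simp add: hom_def)

lemma in_own_hom: "f \<in> Arr C \<Longrightarrow> f \<in> hom C (Dom C f) (Cod C f)"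
  by (simp add: hom_iff)

lemma composable_hom: "f \<in> hom C A B \<Longrightarrow> g \<in> hom C B E \<Longrightarrow> composable C g f"
  by (simp add: hom_iff composable_def)

lemma composable_homE:
  assumes "composable C g f"
  obtains "f \<in> hom C (Dom C f) (Cod C f)" "g \<in> hom C (Cod C f) (Cod C g)"
  using assms by (simp add: hom_iff composable_def)

context
  fixes C :: "('o, 'a) cat"
  assumes C: "category C"
begin

lemma hom_Obj: "f \<in> hom C A B \<Longrightarrow> A \<in> Obj C" "f \<in> hom C A B \<Longrightarrow> B \<in> Obj C"
  using C by (auto simp: category_def hom_iff)

lemma Ident_hom: "A \<in> Obj C \<Longrightarrow> Ident C A \<in> hom C A A"
  using C by (simp add: category_def)

lemma Comp_hom: "f \<in> hom C A B \<Longrightarrow> g \<in> hom C B E \<Longrightarrow> Comp C g f \<in> hom C A E"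
  using C composable_hom[of f C A B g E] by (auto simp: category_def hom_iff)

lemma Comp_Ident_right: "f \<in> hom C A B \<Longrightarrow> Comp C f (Ident C A) = f"
  using C by (auto simp: category_def hom_iff)

lemma Comp_Ident_left: "f \<in> hom C A B \<Longrightarrow> Comp C (Ident C B) f = f"
  using C by (auto simp: category_def hom_iff)

lemma Comp_assoc:
  "f \<in> hom C A B \<Longrightarrow> g \<in> hom C B E \<Longrightarrow> h \<in> hom C E F \<Longrightarrow>
    Comp C h (Comp C g f) = Comp C (Comp C h g) f"
  using C composable_hom[of f C A B g E] composable_hom[of g C B E h F]
  unfolding category_def by blast

end

context
  fixes C :: "('o, 'a) cat" and D :: "('p, 'b) cat" and F :: "('o, 'a, 'p, 'b) func"
  assumes F: "is_functor C D F"
begin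

lemma functor_category: "category C" "category D"
  using F by (auto simp: is_functor_def)

lemma functor_Obj: "A \<in> Obj C \<Longrightarrow> FObj F A \<in> Obj D"
  using F by (auto simp: is_functor_def)

lemma functor_hom: "f \<in> hom C A B \<Longrightarrow> FArr F f \<in> hom D (FObj F A) (FObj F B)"
  using F by (auto simp: is_functor_def hom_iff)

lemma functor_Ident: "A \<in> Obj C \<Longrightarrow> FArr F (Ident C A) = Ident D (FObj F A)"
  using F by (simp add: is_functor_def)

lemma functor_Comp:
  "f \<in> hom C A B \<Longrightarrow> g \<in> hom C B E \<Longrightarrow> FArr F (Comp C g f) = Comp D (FArr F g) (FArr F f)"
  using F composable_hom[of f C A B g E] by (simp add: is_functor_def)

lemma functor_extensional: "FObj F \<in> extensional (Obj C)" "FArr F \<in> extensional (Arr C)"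
  using F by (auto simp: is_functor_def PiE_def)

end

lemma functorI:
  assumes "category C" "category D"
    and "FObj F \<in> extensional (Obj C)" "FArr F \<in> extensional (Arr C)"
    and obj: "\<And>A. A \<in> Obj C \<Longrightarrow> FObj F A \<in> Obj D"
    and arr: "\<And>f A B. f \<in> hom C A B \<Longrightarrow> FArr F f \<in> hom D (FObj F A) (FObj F B)"
    and ident: "\<And>A. A \<in> Obj C \<Longrightarrow> FArr F (Ident C A) = Ident D (FObj F A)"
    and comp: "\<And>f g A B E. f \<in> hom C A B \<Longrightarrow> g \<in> hom C B E \<Longrightarrow>
      FArr F (Comp C g f) = Comp D (FArr F g) (FArr F f)"
  shows "is_functor C D F"
proof -
  have "FArr F f \<in> Arr D \<and> Dom D (FArr F f) = FObj F (Dom C f) \<and>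
      Cod D (FArr F f) = FObj F (Cod C f)" if "f \<in> Arr C" for f
    using arr[OF in_own_hom[OF that]] by (simp add: hom_iff)
  moreover have "FArr F (Comp C g f) = Comp D (FArr F g) (FArr F f)" if "composable C g f" for f g
    using that by (rule composable_homE) (rule comp)
  ultimately show ?thesis
    using assms(1-4) obj ident by (auto simp: is_functor_def PiE_def)
qed

lemma functor_eqI:
  assumes "is_functor C D F" "is_functor C D' G"
    and "\<And>A. A \<in> Obj C \<Longrightarrow> FObj F A = FObj G A"
    and "\<And>f. f \<in> Arr C \<Longrightarrow> FArr F f = FArr G f"
  shows "F = G"
proof -
  have "FObj F = FObj G"
    by (rule extensionalityI) (use assms functor_extensional in blast)+
  moreover have "FArr F = FArr G"
    by (rule extensionalityI) (use assms functor_extensional in blast)+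
  ultimately show ?thesis by simp
qed

lemma id_func_simps [simp]:
  "A \<in> Obj C \<Longrightarrow> FObj (id_func C) A = A"
  "f \<in> Arr C \<Longrightarrow> FArr (id_func C) f = f"
  by (simp_all add: id_func_def)

lemma func_comp_simps [simp]:
  "A \<in> Obj C \<Longrightarrow> FObj (func_comp C G F) A = FObj G (FObj F A)"
  "f \<in> Arr C \<Longrightarrow> FArr (func_comp C G F) f = FArr G (FArr F f)"
  by (simp_all add: func_comp_def compose_def)

lemma id_func_hom [simp]: "f \<in> hom C A B \<Longrightarrow> FArr (id_func C) f = f"
  by (simp add: hom_iff)

lemma func_comp_hom [simp]: "f \<in> hom C A B \<Longrightarrow> FArr (func_comp C G F) f = FArr G (FArr F f)"
  by (simp add: hom_iff)

lemma functor_id_func: "category C \<Longrightarrow> is_functor C C (id_func C)"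
proof (rule functorI)
  assume C: "category C"
  show "FArr (id_func C) f \<in> hom C (FObj (id_func C) A) (FObj (id_func C) B)"
    if "f \<in> hom C A B" for f A B
    using that hom_Obj[OF C that] by simp
  show "FArr (id_func C) (Ident C A) = Ident C (FObj (id_func C) A)" if "A \<in> Obj C" for A
    using that id_func_hom[OF Ident_hom[OF C that]] by simp
  show "FArr (id_func C) (Comp C g f) = Comp C (FArr (id_func C) g) (FArr (id_func C) f)"
    if "f \<in> hom C A B" "g \<in> hom C B E" for f g A B E
    using that id_func_hom[OF Comp_hom[OF C that]] by simp
qed (auto simp: id_func_def)

lemma functor_func_comp:
  assumes F: "is_functor C D F" and G: "is_functor D E G"
  shows "is_functor C E (func_comp C G F)"
proof (rule functorI)
  note C = functor_category(1)[OF F]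
  show "FArr (func_comp C G F) f \<in> hom E (FObj (func_comp C G F) A) (FObj (func_comp C G F) B)"
    if "f \<in> hom C A B" for f A B
    using that hom_Obj[OF C that] functor_hom[OF G functor_hom[OF F that]] by simp
  show "FArr (func_comp C G F) (Ident C A) = Ident E (FObj (func_comp C G F) A)"
    if "A \<in> Obj C" for A
    using that
    by (simp add: func_comp_hom[OF Ident_hom[OF C that]] functor_Ident[OF F] functor_Ident[OF G]
        functor_Obj[OF F])
  show "FArr (func_comp C G F) (Comp C g f) =
      Comp E (FArr (func_comp C G F) g) (FArr (func_comp C G F) f)"
    if "f \<in> hom C A B" "g \<in> hom C B H" for f g A B H
    using that functor_Comp[OF F that]
      functor_Comp[OF G functor_hom[OF F that(1)] functor_hom[OF F that(2)]]
    by (simp add: func_comp_hom[OF Comp_hom[OF C that]])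
qed (use functor_category[OF F] functor_category[OF G] functor_Obj[OF F] functor_Obj[OF G]
  in \<open>auto simp: func_comp_def compose_def\<close>)

lemma functor_Arr: "is_functor C D F \<Longrightarrow> f \<in> Arr C \<Longrightarrow> FArr F f \<in> Arr D"
  by (auto simp: is_functor_def)

lemma func_comp_assoc:
  assumes F: "is_functor C D F"
  shows "func_comp C H (func_comp C G F) = func_comp C (func_comp D H G) F"
  unfolding func_comp_def using functor_Obj[OF F] functor_Arr[OF F]
  by (auto simp: compose_def fun_eq_iff)

lemma func_comp_id_right: "is_functor C D F \<Longrightarrow> func_comp C F (id_func C) = F"
  by (rule functor_eqI[OF functor_func_comp])
    (auto intro: functor_id_func dest: functor_category)

lemma func_comp_id_left: "is_functor C D F \<Longrightarrow> func_comp C (id_func D) F = F"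
  by (rule functor_eqI[OF functor_func_comp])
    (auto intro: functor_id_func dest: functor_category simp: functor_Obj functor_Arr)

lemma nat_transI:
  assumes "is_functor C D F" "is_functor C D G" "\<alpha> \<in> extensional (Obj C)"
    and "\<And>A. A \<in> Obj C \<Longrightarrow> \<alpha> A \<in> hom D (FObj F A) (FObj G A)"
    and "\<And>f A B. f \<in> hom C A B \<Longrightarrow> Comp D (FArr G f) (\<alpha> A) = Comp D (\<alpha> B) (FArr F f)"
  shows "nat_trans C D F G \<alpha>"
  using assms(1-4) assms(5)[OF in_own_hom] by (simp add: nat_trans_def)

context
  fixes C :: "('o, 'a) cat" and D :: "('p, 'b) cat" and F G \<alpha>
  assumes \<alpha>: "nat_trans C D F G \<alpha>"
begin

lemma nat_trans_functors: "is_functor C D F" "is_functor C D G"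
  using \<alpha> by (simp_all add: nat_trans_def)

lemma nat_trans_extensional: "\<alpha> \<in> extensional (Obj C)"
  using \<alpha> by (simp add: nat_trans_def)

lemma nat_trans_hom: "A \<in> Obj C \<Longrightarrow> \<alpha> A \<in> hom D (FObj F A) (FObj G A)"
  using \<alpha> by (simp add: nat_trans_def)

lemma nat_trans_natural:
  "f \<in> hom C A B \<Longrightarrow> Comp D (FArr G f) (\<alpha> A) = Comp D (\<alpha> B) (FArr F f)"
  using \<alpha> by (auto simp: nat_trans_def hom_iff)

end

lemma nat_trans_Ident:
  assumes F: "is_functor C D F"
  shows "nat_trans C D F F (\<lambda>A \<in> Obj C. Ident D (FObj F A))"
proof (rule nat_transI[OF F F])
  note C = functor_category(1)[OF F] and D = functor_category(2)[OF F]
  show "Comp D (FArr F f) ((\<lambda>A \<in> Obj C. Ident D (FObj F A)) A) =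
      Comp D ((\<lambda>A \<in> Obj C. Ident D (FObj F A)) B) (FArr F f)" if "f \<in> hom C A B" for f A B
    using hom_Obj[OF C that] functor_hom[OF F that]
    by (simp add: Comp_Ident_left[OF D] Comp_Ident_right[OF D])
  show "(\<lambda>A \<in> Obj C. Ident D (FObj F A)) A \<in> hom D (FObj F A) (FObj F A)" if "A \<in> Obj C" for A
    using that Ident_hom[OF D functor_Obj[OF F that]] by simp
qed simp

lemma nat_trans_whisker_left:
  assumes \<alpha>: "nat_trans C D F G \<alpha>" and H: "is_functor D E H"
  shows "nat_trans C E (func_comp C H F) (func_comp C H G) (whisker_left C H \<alpha>)"
proof (rule nat_transI)
  note F = nat_trans_functors(1)[OF \<alpha>] and G = nat_trans_functors(2)[OF \<alpha>]
  note C = functor_category(1)[OF F]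
  show "is_functor C E (func_comp C H F)" "is_functor C E (func_comp C H G)"
    by (rule functor_func_comp[OF F H] functor_func_comp[OF G H])+
  show "whisker_left C H \<alpha> A \<in> hom E (FObj (func_comp C H F) A) (FObj (func_comp C H G) A)"
    if "A \<in> Obj C" for A
    using that functor_hom[OF H nat_trans_hom[OF \<alpha> that]] by (simp add: whisker_left_def)
  show "Comp E (FArr (func_comp C H G) f) (whisker_left C H \<alpha> A) =
      Comp E (whisker_left C H \<alpha> B) (FArr (func_comp C H F) f)" if f: "f \<in> hom C A B" for f A B
    using f hom_Obj[OF C f] nat_trans_natural[OF \<alpha> f]
      functor_Comp[OF H nat_trans_hom[OF \<alpha>] functor_hom[OF G f]]
      functor_Comp[OF H functor_hom[OF F f] nat_trans_hom[OF \<alpha>]]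
    by (simp add: whisker_left_def)
qed (simp add: whisker_left_def)

lemma nat_trans_whisker_right:
  assumes \<alpha>: "nat_trans D E G H \<alpha>" and F: "is_functor C D F"
  shows "nat_trans C E (func_comp C G F) (func_comp C H F) (whisker_right C \<alpha> F)"
proof (rule nat_transI)
  note C = functor_category(1)[OF F]
  show "is_functor C E (func_comp C G F)" "is_functor C E (func_comp C H F)"
    by (rule functor_func_comp[OF F] nat_trans_functors[OF \<alpha>])+
  show "whisker_right C \<alpha> F A \<in> hom E (FObj (func_comp C G F) A) (FObj (func_comp C H F) A)"
    if "A \<in> Obj C" for A
    using that nat_trans_hom[OF \<alpha> functor_Obj[OF F that]] by (simp add: whisker_right_def)
  show "Comp E (FArr (func_comp C H F) f) (whisker_right C \<alpha> F A) =
      Comp E (whisker_right C \<alpha> F B) (FArr (func_comp C G F) f)" if f: "f \<in> hom C A B" for f A B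
    using f hom_Obj[OF C f] nat_trans_natural[OF \<alpha> functor_hom[OF F f]]
    by (simp add: whisker_right_def)
qed (simp add: whisker_right_def)

lemma nat_trans_vert_comp:
  assumes \<alpha>: "nat_trans C D F G \<alpha>" and \<beta>: "nat_trans C D G H \<beta>"
  shows "nat_trans C D F H (vert_comp C D \<beta> \<alpha>)"
proof (rule nat_transI[OF nat_trans_functors(1)[OF \<alpha>] nat_trans_functors(2)[OF \<beta>]])
  note F = nat_trans_functors(1)[OF \<alpha>] and G = nat_trans_functors(2)[OF \<alpha>]
    and H = nat_trans_functors(2)[OF \<beta>]
  note C = functor_category(1)[OF F] and D = functor_category(2)[OF F]
  show "vert_comp C D \<beta> \<alpha> A \<in> hom D (FObj F A) (FObj H A)" if "A \<in> Obj C" for A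
    using that Comp_hom[OF D nat_trans_hom[OF \<alpha> that] nat_trans_hom[OF \<beta> that]]
    by (simp add: vert_comp_def)
  show "Comp D (FArr H f) (vert_comp C D \<beta> \<alpha> A) = Comp D (vert_comp C D \<beta> \<alpha> B) (FArr F f)"
    if f: "f \<in> hom C A B" for f A B
  proof -
    note A = hom_Obj(1)[OF C f] and B = hom_Obj(2)[OF C f]
    have "Comp D (FArr H f) (Comp D (\<beta> A) (\<alpha> A)) = Comp D (Comp D (FArr H f) (\<beta> A)) (\<alpha> A)"
      by (rule Comp_assoc[OF D nat_trans_hom[OF \<alpha> A] nat_trans_hom[OF \<beta> A] functor_hom[OF H f]])
    also have "\<dots> = Comp D (Comp D (\<beta> B) (FArr G f)) (\<alpha> A)"
      by (simp add: nat_trans_natural[OF \<beta> f])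
    also have "\<dots> = Comp D (\<beta> B) (Comp D (FArr G f) (\<alpha> A))"
      by (rule Comp_assoc[OF D nat_trans_hom[OF \<alpha> A] functor_hom[OF G f] nat_trans_hom[OF \<beta> B],
            symmetric])
    also have "\<dots> = Comp D (\<beta> B) (Comp D (\<alpha> B) (FArr F f))"
      by (simp add: nat_trans_natural[OF \<alpha> f])
    also have "\<dots> = Comp D (Comp D (\<beta> B) (\<alpha> B)) (FArr F f)"
      by (rule Comp_assoc[OF D functor_hom[OF F f] nat_trans_hom[OF \<alpha> B] nat_trans_hom[OF \<beta> B]])
    finally show ?thesis using A B by (simp add: vert_comp_def)
  qed
qed (simp add: vert_comp_def)

lemma adjoint_situationD:
  assumes "adjoint_situation X A F G \<eta> \<epsilon>"
  shows "is_functor X A F" "is_functor A X G"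
    "nat_trans X X (id_func X) (func_comp X G F) \<eta>"
    "nat_trans A A (func_comp A F G) (id_func A) \<epsilon>"
    "x \<in> Obj X \<Longrightarrow> Comp A (\<epsilon> (FObj F x)) (FArr F (\<eta> x)) = Ident A (FObj F x)"
    "a \<in> Obj A \<Longrightarrow> Comp X (FArr G (\<epsilon> a)) (\<eta> (FObj G a)) = Ident X (FObj G a)"
  using assms by (simp_all add: adjoint_situation_def)

lemma full_embeddingD:
  assumes "full_embedding C D F"
  shows "is_functor C D F"
    and "A \<in> Obj C \<Longrightarrow> B \<in> Obj C \<Longrightarrow> g \<in> hom D (FObj F A) (FObj F B) \<Longrightarrow>
      \<exists>f \<in> hom C A B. g = FArr F f"
    and "f \<in> hom C A B \<Longrightarrow> f' \<in> hom C A B \<Longrightarrow> FArr F f = FArr F f' \<Longrightarrow> f = f'"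
    and "A \<in> Obj C \<Longrightarrow> B \<in> Obj C \<Longrightarrow> FObj F A = FObj F B \<Longrightarrow> A = B"
proof -
  show F: "is_functor C D F"
    using assms by (simp add: full_embedding_def)
  show "\<exists>f \<in> hom C A B. g = FArr F f"
    if "A \<in> Obj C" "B \<in> Obj C" "g \<in> hom D (FObj F A) (FObj F B)"
    using that assms by (fastforce simp: full_embedding_def image_iff)
  show "f = f'" if "f \<in> hom C A B" "f' \<in> hom C A B" "FArr F f = FArr F f'"
    using that assms hom_Obj[OF functor_category(1)[OF F] that(1)]
    unfolding full_embedding_def by (blast dest: inj_onD)
  show "A = B" if "A \<in> Obj C" "B \<in> Obj C" "FObj F A = FObj F B"
    using that assms by (auto simp: full_embedding_def dest: inj_onD)
qed

lemma full_embeddingI: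
  assumes F: "is_functor C D F"
    and full: "\<And>A B g. A \<in> Obj C \<Longrightarrow> B \<in> Obj C \<Longrightarrow> g \<in> hom D (FObj F A) (FObj F B) \<Longrightarrow>
      \<exists>f \<in> hom C A B. g = FArr F f"
    and faithful: "\<And>A B f f'. f \<in> hom C A B \<Longrightarrow> f' \<in> hom C A B \<Longrightarrow> FArr F f = FArr F f' \<Longrightarrow> f = f'"
    and inj: "\<And>A B. A \<in> Obj C \<Longrightarrow> B \<in> Obj C \<Longrightarrow> FObj F A = FObj F B \<Longrightarrow> A = B"
  shows "full_embedding C D F"
  unfolding full_embedding_def
proof (intro conjI ballI)
  fix A B assume AB: "A \<in> Obj C" "B \<in> Obj C"
  show "FArr F ` hom C A B = hom D (FObj F A) (FObj F B)"
    using functor_hom[OF F] full[OF AB] by blast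
  show "inj_on (FArr F) (hom C A B)"
    using faithful by (rule inj_onI)
next
  show "inj_on (FObj F) (Obj C)"
    using inj by (rule inj_onI)
qed (rule F)

section \<open>Full embeddings with a left adjoint\<close>

text \<open>
  Besides dropping objects and arrows, the operations are made \<open>undefined\<close> outside the smaller
  domains, since otherwise the result would not satisfy \<open>category\<close>.
\<close>

definition full_sub :: "'o set \<Rightarrow> ('o, 'a) cat \<Rightarrow> ('o, 'a) cat" where
  "full_sub Ob C = (let Ar = {f \<in> Arr C. Dom C f \<in> Ob \<and> Cod C f \<in> Ob} in
     \<lparr>Obj = Ob, Arr = Ar, Dom = restrict (Dom C) Ar, Cod = restrict (Cod C) Ar,
      Ident = restrict (Ident C) Ob,
      Comp = (\<lambda>g f. if composable C g f \<and> Dom C f \<in> Ob \<and> Cod C f \<in> Ob \<and> Cod C g \<in> Ob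
                     then Comp C g f else undefined)\<rparr>)"

lemma full_sub_simps [simp]:
  "Obj (full_sub Ob C) = Ob"
  "f \<in> Arr (full_sub Ob C) \<longleftrightarrow> f \<in> Arr C \<and> Dom C f \<in> Ob \<and> Cod C f \<in> Ob"
  by (auto simp: full_sub_def Let_def)

lemma full_sub_hom [simp]: "A \<in> Ob \<Longrightarrow> B \<in> Ob \<Longrightarrow> hom (full_sub Ob C) A B = hom C A B"
  by (auto simp: hom_def full_sub_def Let_def)

lemma full_sub_composable:
  "composable (full_sub Ob C) g f \<longleftrightarrow>
    composable C g f \<and> Dom C f \<in> Ob \<and> Cod C f \<in> Ob \<and> Cod C g \<in> Ob"
  by (auto simp: composable_def full_sub_def Let_def)

lemma full_sub_Comp [simp]:
  "composable (full_sub Ob C) g f \<Longrightarrow> Comp (full_sub Ob C) g f = Comp C g f"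
  unfolding full_sub_composable by (simp add: full_sub_def Let_def)

lemma full_subcategory_full_sub:
  assumes C: "category C" and Ob: "Ob \<subseteq> Obj C"
  shows "full_subcategory (full_sub Ob C) C"
proof -
  let ?R = "full_sub Ob C"
  have dc: "Dom ?R f = Dom C f" "Cod ?R f = Cod C f" if "f \<in> Arr ?R" for f
    using that by (auto simp: full_sub_def Let_def)
  have ident: "Ident ?R A = Ident C A" if "A \<in> Ob" for A
    using that by (simp add: full_sub_def Let_def)
  have comp: "composable ?R (Comp C h g) f \<and> composable ?R h (Comp C g f)"
    if "composable ?R g f" "composable ?R h g" for f g h
    using that Comp_hom[OF C] unfolding full_sub_composable
    by (auto simp: composable_def hom_iff)
  have "category ?R"
    unfolding category_def
  proof (intro conjI allI impI ballI)
    show "Dom ?R \<in> Arr ?R \<rightarrow>\<^sub>E Obj ?R" "Cod ?R \<in> Arr ?R \<rightarrow>\<^sub>E Obj ?R"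
      "Ident ?R \<in> extensional (Obj ?R)"
      by (auto simp: full_sub_def Let_def)
    show "Ident ?R A \<in> hom ?R A A" if "A \<in> Obj ?R" for A
      using that Ob Ident_hom[OF C, of A] ident by auto
    show "Comp ?R g f = undefined" if "\<not> composable ?R g f" for f g
      using that unfolding full_sub_composable by (auto simp: full_sub_def Let_def)
    show "Comp ?R g f \<in> hom ?R (Dom ?R f) (Cod ?R g)" if "composable ?R g f" for f g
    proof -
      have fg: "f \<in> Arr ?R" "g \<in> Arr ?R" "composable C g f"
        using that unfolding full_sub_composable by (auto simp: composable_def)
      then have "Comp C g f \<in> hom C (Dom C f) (Cod C g)"
        using C by (simp add: category_def)
      then show ?thesis
        using that fg dc by simp
    qed
    show "Comp ?R f (Ident ?R (Dom ?R f)) = f" "Comp ?R (Ident ?R (Cod ?R f)) f = f"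
      if f: "f \<in> Arr ?R" for f
    proof -
      have "Dom C f \<in> Obj C" "Cod C f \<in> Obj C"
        using f Ob by auto
      from this[THEN Ident_hom[OF C]] f
      have "composable ?R f (Ident C (Dom C f))" "composable ?R (Ident C (Cod C f)) f"
        unfolding full_sub_composable by (auto simp: composable_def hom_iff)
      then show "Comp ?R f (Ident ?R (Dom ?R f)) = f" "Comp ?R (Ident ?R (Cod ?R f)) f = f"
        using f dc ident C by (simp_all add: category_def)
    qed
    show "Comp ?R h (Comp ?R g f) = Comp ?R (Comp ?R h g) f"
      if "composable ?R g f \<and> composable ?R h g" for f g h
    proof -
      have "composable C g f" "composable C h g"
        using that by (auto simp: full_sub_composable)
      then have "Comp C h (Comp C g f) = Comp C (Comp C h g) f"
        using C by (auto simp: category_def)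
      then show ?thesis
        using that comp[of g f h] by simp
    qed
  qed
  then show ?thesis
    using C Ob dc ident by (auto simp: full_subcategory_def)
qed

text \<open>
  Injectivity on objects makes arrows with equal images parallel, so faithfulness extends to
  injectivity on the whole set of arrows. The inverses of the two maps then form a functor.
\<close>

lemma isomorphic_full_sub_image:
  assumes F: "full_embedding C D F"
  shows "isomorphic_cats C (full_sub (FObj F ` Obj C) D)"
proof -
  let ?R = "full_sub (FObj F ` Obj C) D"
  note FF = full_embeddingD(1)[OF F]
  note C = functor_category(1)[OF FF] and D = functor_category(2)[OF FF]
  have sub: "FObj F ` Obj C \<subseteq> Obj D"
    using functor_Obj[OF FF] by blast
  have R: "category ?R"
    using full_subcategory_full_sub[OF D sub] by (simp add: full_subcategory_def)
  have F_R_hom: "FArr F f \<in> hom ?R (FObj F A) (FObj F B)" if "f \<in> hom C A B" for f A B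
    using functor_hom[OF FF that] hom_Obj[OF C that] by simp
  have identR: "Ident ?R A = Ident D A" if "A \<in> FObj F ` Obj C" for A
    using that by (simp add: full_sub_def Let_def)
  have compR: "Comp ?R (FArr F g) (FArr F f) = FArr F (Comp C g f)"
    if "f \<in> hom C A B" "g \<in> hom C B E" for f g A B E
    using composable_hom[OF F_R_hom[OF that(1)] F_R_hom[OF that(2)]] functor_Comp[OF FF that]
    by simp
  have F_R: "is_functor C ?R F"
    by (rule functorI[OF C R functor_extensional[OF FF]])
      (use F_R_hom functor_Ident[OF FF] identR compR in auto)
  have Arr_R: "\<exists>A B f. A \<in> Obj C \<and> B \<in> Obj C \<and> f \<in> hom C A B \<and> g = FArr F f"
    if g: "g \<in> Arr ?R" for g
  proof -
    obtain A B where AB: "A \<in> Obj C" "B \<in> Obj C" "g \<in> hom D (FObj F A) (FObj F B)"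
      using g by (auto simp: hom_iff)
    with full_embeddingD(2)[OF F AB] show ?thesis by blast
  qed
  have inj_Arr: "inj_on (FArr F) (Arr C)"
  proof (rule inj_onI)
    fix f f' assume f: "f \<in> Arr C" "f' \<in> Arr C" and eq: "FArr F f = FArr F f'"
    note h = in_own_hom[OF f(1)] in_own_hom[OF f(2)]
    have "FObj F (Dom C f) = FObj F (Dom C f')" "FObj F (Cod C f) = FObj F (Cod C f')"
      using eq functor_hom[OF FF h(1)] functor_hom[OF FF h(2)] by (auto simp: hom_iff)
    then have "Dom C f = Dom C f'" "Cod C f = Cod C f'"
      using full_embeddingD(4)[OF F] hom_Obj[OF C h(1)] hom_Obj[OF C h(2)] by blast+
    then show "f = f'"
      using full_embeddingD(3)[OF F h(1) _ eq] h(2) by simp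
  qed
  have inj_Obj: "inj_on (FObj F) (Obj C)"
    using F by (simp add: full_embedding_def)
  define G where "G = \<lparr>FObj = restrict (inv_into (Obj C) (FObj F)) (Obj ?R),
    FArr = restrict (inv_into (Arr C) (FArr F)) (Arr ?R)\<rparr>"
  have GObj: "FObj G (FObj F A) = A" if "A \<in> Obj C" for A
    using that inj_Obj by (simp add: G_def)
  have GArr: "FArr G (FArr F f) = f" if "f \<in> hom C A B" for f A B
    using that inj_Arr F_R_hom[OF that] by (simp add: G_def hom_iff)
  have G: "is_functor ?R C G"
  proof (rule functorI[OF R C])
    show "FObj G \<in> extensional (Obj ?R)" "FArr G \<in> extensional (Arr ?R)"
      by (simp_all add: G_def)
    show "FObj G A \<in> Obj C" if "A \<in> Obj ?R" for A
      using that GObj by auto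
    show "FArr G f \<in> hom C (FObj G A) (FObj G B)" if f: "f \<in> hom ?R A B" for f A B
    proof -
      obtain A' B' where "A' \<in> Obj C" "B' \<in> Obj C" "A = FObj F A'" "B = FObj F B'"
        using hom_Obj[OF R f] by auto
      moreover obtain f' where "f' \<in> hom C A' B'" "f = FArr F f'"
        using full_embeddingD(2)[OF F, of A' B' f] calculation f by auto
      ultimately show ?thesis using GObj GArr by simp
    qed
    show "FArr G (Ident ?R A) = Ident C (FObj G A)" if A: "A \<in> Obj ?R" for A
    proof -
      obtain A' where A': "A' \<in> Obj C" "A = FObj F A'" using A by auto
      then show ?thesis
        using GArr[OF Ident_hom[OF C A'(1)]] functor_Ident[OF F_R A'(1)] GObj by simp
    qed
    show "FArr G (Comp ?R g f) = Comp C (FArr G g) (FArr G f)"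
      if fg: "f \<in> hom ?R A B" "g \<in> hom ?R B E" for f g A B E
    proof -
      obtain A' B' E' where *: "A' \<in> Obj C" "B' \<in> Obj C" "E' \<in> Obj C"
        "A = FObj F A'" "B = FObj F B'" "E = FObj F E'"
        using hom_Obj[OF R fg(1)] hom_Obj[OF R fg(2)] by auto
      moreover obtain f' where f': "f' \<in> hom C A' B'" "f = FArr F f'"
        using full_embeddingD(2)[OF F, of A' B' f] * fg by auto
      moreover obtain g' where g': "g' \<in> hom C B' E'" "g = FArr F g'"
        using full_embeddingD(2)[OF F, of B' E' g] * fg by auto
      ultimately show ?thesis
        using GArr[OF f'(1)] GArr[OF g'(1)] GArr[OF Comp_hom[OF C f'(1) g'(1)]]
          compR[OF f'(1) g'(1)] by simp
    qed
  qed
  have "func_comp C G F = id_func C"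
    by (rule functor_eqI[OF functor_func_comp[OF F_R G] functor_id_func[OF C]])
      (auto simp: GObj GArr[OF in_own_hom])
  moreover have "func_comp ?R F G = id_func ?R"
  proof (rule functor_eqI[OF functor_func_comp[OF G F_R] functor_id_func[OF R]])
    show "FObj (func_comp ?R F G) A = FObj (id_func ?R) A" if "A \<in> Obj ?R" for A
      using that GObj by auto
    show "FArr (func_comp ?R F G) f = FArr (id_func ?R) f" if "f \<in> Arr ?R" for f
      using that Arr_R[OF that] GArr by (auto simp del: full_sub_simps)
  qed
  ultimately show ?thesis
    using F_R G by (auto simp: isomorphic_cats_def)
qed

text \<open>
  The reflection arrows are the components of the unit: an arrow \<open>f : A \<rightarrow> F B'\<close> factors through
  \<open>\<eta>\<^sub>A\<close> by its transpose \<open>\<epsilon> \<circ> L f\<close>. Fullness of \<open>F\<close> gives uniqueness, as every factor is \<open>F h\<close> for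
  some \<open>h\<close>, and \<open>h\<close> is recovered as the transpose of \<open>f\<close>.
\<close>

lemma full_reflective_image:
  assumes F: "full_embedding C D F" and adj: "adjoint_situation D C L F \<eta> \<epsilon>"
  shows "full_reflective_subcategory (full_sub (FObj F ` Obj C) D) D"
  unfolding full_reflective_subcategory_def
proof (intro conjI ballI)
  let ?R = "full_sub (FObj F ` Obj C) D"
  note FF = adjoint_situationD(2)[OF adj] and L = adjoint_situationD(1)[OF adj]
  note \<eta> = adjoint_situationD(3)[OF adj] and \<epsilon> = adjoint_situationD(4)[OF adj]
  note C = functor_category(1)[OF FF] and D = functor_category(2)[OF FF]
  show "full_subcategory ?R D"
    using functor_Obj[OF FF] by (auto intro!: full_subcategory_full_sub D)
  fix A assume A: "A \<in> Obj D"
  note LA = functor_Obj[OF L A]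
  have \<eta>A: "\<eta> A \<in> hom D A (FObj F (FObj L A))"
    using nat_trans_hom[OF \<eta> A] A by simp
  have "\<exists>!g. g \<in> hom ?R (FObj F (FObj L A)) B \<and> f = Comp D g (\<eta> A)"
    if B: "B \<in> Obj ?R" and f: "f \<in> hom D A B" for B f
  proof -
    obtain B' where B': "B' \<in> Obj C" "B = FObj F B'"
      using B by auto
    have \<epsilon>B: "\<epsilon> B' \<in> hom C (FObj L (FObj F B')) B'"
      using nat_trans_hom[OF \<epsilon> B'(1)] B' by simp
    have \<epsilon>LA: "\<epsilon> (FObj L A) \<in> hom C (FObj L (FObj F (FObj L A))) (FObj L A)"
      using nat_trans_hom[OF \<epsilon> LA] LA by simp
    note Lf = functor_hom[OF L f[unfolded B'(2)]]
    show ?thesis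
    proof (rule ex1I)
      let ?g = "FArr F (Comp C (\<epsilon> B') (FArr L f))"
      have "f = Comp D (FArr F (\<epsilon> B')) (Comp D (\<eta> B) f)"
        using Comp_assoc[OF D f[unfolded B'(2)] _ functor_hom[OF FF \<epsilon>B], of "\<eta> B"]
          adjoint_situationD(6)[OF adj B'(1)] Comp_Ident_left[OF D f]
          nat_trans_hom[OF \<eta>, of B] functor_Obj[OF FF B'(1)] B' by simp
      also have "Comp D (\<eta> B) f = Comp D (FArr F (FArr L f)) (\<eta> A)"
        using nat_trans_natural[OF \<eta> f] f by simp
      also have "Comp D (FArr F (\<epsilon> B')) \<dots> = Comp D ?g (\<eta> A)"
        using Comp_assoc[OF D \<eta>A functor_hom[OF FF Lf] functor_hom[OF FF \<epsilon>B]]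
          functor_Comp[OF FF Lf \<epsilon>B] by simp
      finally show "?g \<in> hom ?R (FObj F (FObj L A)) B \<and> f = Comp D ?g (\<eta> A)"
        using functor_hom[OF FF Comp_hom[OF C Lf \<epsilon>B]] B' LA by simp
    next
      fix g assume g: "g \<in> hom ?R (FObj F (FObj L A)) B \<and> f = Comp D g (\<eta> A)"
      then have "g \<in> hom D (FObj F (FObj L A)) (FObj F B')"
        using B' LA by simp
      then obtain h where h: "h \<in> hom C (FObj L A) B'" and gh: "g = FArr F h"
        using full_embeddingD(2)[OF F LA B'(1)] by blast
      note Fh = functor_hom[OF FF h]
      have "Comp C (\<epsilon> B') (FArr L f) =
          Comp C (\<epsilon> B') (Comp C (FArr L (FArr F h)) (FArr L (\<eta> A)))"
        using g gh functor_Comp[OF L \<eta>A Fh] by simp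
      also have "\<dots> = Comp C (Comp C (\<epsilon> B') (FArr L (FArr F h))) (FArr L (\<eta> A))"
        by (rule Comp_assoc[OF C functor_hom[OF L \<eta>A] functor_hom[OF L Fh] \<epsilon>B])
      also have "\<dots> = Comp C (Comp C h (\<epsilon> (FObj L A))) (FArr L (\<eta> A))"
        using nat_trans_natural[OF \<epsilon> h] h by simp
      also have "\<dots> = Comp C h (Comp C (\<epsilon> (FObj L A)) (FArr L (\<eta> A)))"
        by (rule Comp_assoc[OF C functor_hom[OF L \<eta>A] \<epsilon>LA h, symmetric])
      also have "\<dots> = h"
        using adjoint_situationD(5)[OF adj A] Comp_Ident_right[OF C h] by simp
      finally show "g = FArr F (Comp C (\<epsilon> B') (FArr L f))"
        using gh by simp
    qed
  qed
  then have "reflection_arrow ?R D A (FObj F (FObj L A)) (\<eta> A)"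
    using \<eta>A LA by (auto simp: reflection_arrow_def)
  then show "\<exists>A' r. reflection_arrow ?R D A A' r" by blast
qed


section \<open>Categories given by labelled hom-sets\<close>

lemma hom_cat_Obj [simp]: "Obj (hom_cat Ob H i c) = Ob"
  by (simp add: hom_cat_def)

lemma hom_cat_Ident [simp]: "A \<in> Ob \<Longrightarrow> Ident (hom_cat Ob H i c) A = Arrow A (i A) A"
  by (simp add: hom_cat_def)

lemma hom_cat_hom:
  "h \<in> hom (hom_cat Ob H i c) A B \<longleftrightarrow> A \<in> Ob \<and> B \<in> Ob \<and> (\<exists>m \<in> H A B. h = Arrow A m B)"
  by (auto simp: hom_def hom_cat_def hom_arrows_def)

lemma hom_cat_Comp:
  "A \<in> Ob \<Longrightarrow> B \<in> Ob \<Longrightarrow> E \<in> Ob \<Longrightarrow> m \<in> H A B \<Longrightarrow> n \<in> H B E \<Longrightarrow>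
    Comp (hom_cat Ob H i c) (Arrow B n E) (Arrow A m B) = Arrow A (c A n m) E"
  by (auto simp: hom_cat_def hom_arrows_def)

lemma category_hom_cat:
  assumes i: "\<And>A. A \<in> Ob \<Longrightarrow> i A \<in> H A A"
    and c: "\<And>A B E m n. A \<in> Ob \<Longrightarrow> B \<in> Ob \<Longrightarrow> E \<in> Ob \<Longrightarrow> m \<in> H A B \<Longrightarrow> n \<in> H B E \<Longrightarrow>
      c A n m \<in> H A E"
    and right: "\<And>A B m. A \<in> Ob \<Longrightarrow> B \<in> Ob \<Longrightarrow> m \<in> H A B \<Longrightarrow> c A m (i A) = m"
    and left: "\<And>A B m. A \<in> Ob \<Longrightarrow> B \<in> Ob \<Longrightarrow> m \<in> H A B \<Longrightarrow> c A (i B) m = m"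
    and assoc: "\<And>A B E F m n k. A \<in> Ob \<Longrightarrow> B \<in> Ob \<Longrightarrow> E \<in> Ob \<Longrightarrow> F \<in> Ob \<Longrightarrow>
      m \<in> H A B \<Longrightarrow> n \<in> H B E \<Longrightarrow> k \<in> H E F \<Longrightarrow> c A k (c A n m) = c A (c B k n) m"
  shows "category (hom_cat Ob H i c)"
proof -
  let ?C = "hom_cat Ob H i c"
  have arrE: "\<exists>A B m. A \<in> Ob \<and> B \<in> Ob \<and> m \<in> H A B \<and> f = Arrow A m B" if "f \<in> Arr ?C" for f
    using that by (auto simp: hom_cat_def hom_arrows_def)
  have dc [simp]: "Dom ?C (Arrow A m B) = A" "Cod ?C (Arrow A m B) = B"
    if "A \<in> Ob" "B \<in> Ob" "m \<in> H A B" for A B m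
    using that hom_cat_hom[of "Arrow A m B" Ob H i c A B] by (auto simp: hom_iff)
  have compE: "\<exists>A B E m n. A \<in> Ob \<and> B \<in> Ob \<and> E \<in> Ob \<and> m \<in> H A B \<and> n \<in> H B E \<and>
      f = Arrow A m B \<and> g = Arrow B n E" if "composable ?C g f" for f g
    using that arrE[of f] arrE[of g] by (auto simp: composable_def)
  show ?thesis
    unfolding category_def
  proof (intro conjI allI impI ballI)
    show "Dom ?C \<in> Arr ?C \<rightarrow>\<^sub>E Obj ?C" "Cod ?C \<in> Arr ?C \<rightarrow>\<^sub>E Obj ?C"
      by (auto simp: hom_cat_def hom_arrows_def)
    show "Ident ?C \<in> extensional (Obj ?C)"
      by (simp add: hom_cat_def)
    show "Ident ?C A \<in> hom ?C A A" if "A \<in> Obj ?C" for A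
      using that i by (simp add: hom_cat_hom)
    show "Comp ?C g f = undefined" if "\<not> composable ?C g f" for f g
      using that by (auto simp: hom_cat_def composable_def)
    show "Comp ?C g f \<in> hom ?C (Dom ?C f) (Cod ?C g)" if "composable ?C g f" for f g
      using compE[OF that] c by (auto simp: hom_cat_hom hom_cat_Comp)
    show "Comp ?C f (Ident ?C (Dom ?C f)) = f" "Comp ?C (Ident ?C (Cod ?C f)) f = f"
      if "f \<in> Arr ?C" for f
      using arrE[OF that] i right left by (auto simp: hom_cat_Comp)
    show "Comp ?C h (Comp ?C g f) = Comp ?C (Comp ?C h g) f"
      if gf: "composable ?C g f \<and> composable ?C h g" for f g h
    proof -
      obtain A B E m n where 1: "A \<in> Ob" "B \<in> Ob" "E \<in> Ob" "m \<in> H A B" "n \<in> H B E"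
        "f = Arrow A m B" "g = Arrow B n E"
        using gf compE[of g f] by blast
      moreover obtain F k where 2: "F \<in> Ob" "k \<in> H E F" "h = Arrow E k F"
        using gf compE[of h g] 1 by auto
      ultimately show ?thesis
        using c[OF 1(1,2,3,4,5)] c[OF 1(2,3) 2(1) 1(5) 2(2)] assoc[OF 1(1,2,3) 2(1) 1(4,5) 2(2)]
        by (simp add: hom_cat_Comp)
    qed
  qed
qed

section \<open>Institutions over a varying base category\<close>

lemma Inst_Obj: "(S, I) \<in> Obj (Inst D) \<longleftrightarrow> is_functor S D I"
  by (auto simp: Inst_def dest: functor_category)

lemma Inst_hom:
  "h \<in> hom (Inst D) (S1, I1) (S2, I2) \<longleftrightarrow>
    is_functor S1 D I1 \<and> is_functor S2 D I2 \<and>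
    (\<exists>\<Phi> \<alpha>. h = Arrow (S1, I1) (\<Phi>, \<alpha>) (S2, I2) \<and>
      is_functor S1 S2 \<Phi> \<and> nat_trans S1 D I1 (func_comp S1 I2 \<Phi>) \<alpha>)"
  by (auto simp: Inst_def hom_cat_hom dest: functor_category)

lemma Inst_homI:
  assumes "is_functor S2 D I2" "is_functor S1 S2 \<Phi>" "nat_trans S1 D I1 (func_comp S1 I2 \<Phi>) \<alpha>"
  shows "Arrow (S1, I1) (\<Phi>, \<alpha>) (S2, I2) \<in> hom (Inst D) (S1, I1) (S2, I2)"
  using assms nat_trans_functors(1)[OF assms(3)] by (simp add: Inst_hom)

lemma Inst_homE:
  assumes "h \<in> hom (Inst D) P Q"
  obtains S1 I1 S2 I2 \<Phi> \<alpha> where "P = (S1, I1)" "Q = (S2, I2)"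
    "h = Arrow (S1, I1) (\<Phi>, \<alpha>) (S2, I2)"
    "is_functor S1 D I1" "is_functor S2 D I2"
    "is_functor S1 S2 \<Phi>" "nat_trans S1 D I1 (func_comp S1 I2 \<Phi>) \<alpha>"
  using assms by (cases P; cases Q) (auto simp: Inst_hom)

lemma Inst_Ident:
  "is_functor S D I \<Longrightarrow> Ident (Inst D) (S, I) =
    Arrow (S, I) (id_func S, \<lambda>s \<in> Obj S. Ident D (FObj I s)) (S, I)"
  by (simp add: Inst_def functor_category)

lemma Inst_Comp:
  assumes "Arrow (S1, I1) (\<Phi>, \<alpha>) (S2, I2) \<in> hom (Inst D) (S1, I1) (S2, I2)"
    and "Arrow (S2, I2) (\<Psi>, \<beta>) (S3, I3) \<in> hom (Inst D) (S2, I2) (S3, I3)"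
  shows "Comp (Inst D) (Arrow (S2, I2) (\<Psi>, \<beta>) (S3, I3)) (Arrow (S1, I1) (\<Phi>, \<alpha>) (S2, I2)) =
    Arrow (S1, I1) (func_comp S1 \<Psi> \<Phi>, vert_comp S1 D (whisker_right S1 \<beta> \<Phi>) \<alpha>) (S3, I3)"
  using assms unfolding Inst_def by (subst hom_cat_Comp) (auto simp: hom_cat_hom)

text \<open>
  The whiskered transformation \<open>\<beta> \<Phi>\<close> ends in \<open>(I\<^sub>3 \<Psi>) \<Phi>\<close>, whereas the composite institution morphism
  needs \<open>I\<^sub>3 (\<Psi> \<Phi>)\<close>; associativity of functor composition is an equation, which closes the gap.
\<close>

lemma inst_label_comp:
  assumes "is_functor S1 S2 \<Phi>" "nat_trans S1 D I1 (func_comp S1 I2 \<Phi>) \<alpha>"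
    and "is_functor S2 S3 \<Psi>" "nat_trans S2 D I2 (func_comp S2 I3 \<Psi>) \<beta>"
  shows "is_functor S1 S3 (func_comp S1 \<Psi> \<Phi>)"
    and "nat_trans S1 D I1 (func_comp S1 I3 (func_comp S1 \<Psi> \<Phi>))
      (vert_comp S1 D (whisker_right S1 \<beta> \<Phi>) \<alpha>)"
  using functor_func_comp[OF assms(1,3)]
    nat_trans_vert_comp[OF assms(2) nat_trans_whisker_right[OF assms(4,1)]]
  by (simp_all add: func_comp_assoc[OF assms(1)])

lemma category_Inst: "category (Inst D)"
  unfolding Inst_def
proof (rule category_hom_cat, goal_cases)
  case (1 A)
  then show ?case
    by (auto simp: functor_id_func func_comp_id_right nat_trans_Ident)
next
  case (2 A B E m n)
  then show ?case
    by (auto intro: inst_label_comp)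
next
  case (3 A B m)
  obtain S1 I1 S2 I2 \<Phi> \<alpha> where *: "A = (S1, I1)" "B = (S2, I2)" "m = (\<Phi>, \<alpha>)"
    by (cases A; cases B; cases m)
  with 3 have \<Phi>: "is_functor S1 S2 \<Phi>" and \<alpha>: "nat_trans S1 D I1 (func_comp S1 I2 \<Phi>) \<alpha>"
    and D: "category D" by (auto dest: functor_category)
  have "vert_comp S1 D (whisker_right S1 \<alpha> (id_func S1)) (\<lambda>s\<in>Obj S1. Ident D (FObj I1 s)) = \<alpha>"
    by (rule extensionalityI[OF _ nat_trans_extensional[OF \<alpha>]])
      (auto simp: vert_comp_def whisker_right_def Comp_Ident_right[OF D nat_trans_hom[OF \<alpha>]])
  then show ?case
    using * by (simp add: func_comp_id_right[OF \<Phi>])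
next
  case (4 A B m)
  obtain S1 I1 S2 I2 \<Phi> \<alpha> where *: "A = (S1, I1)" "B = (S2, I2)" "m = (\<Phi>, \<alpha>)"
    by (cases A; cases B; cases m)
  with 4 have \<Phi>: "is_functor S1 S2 \<Phi>" and \<alpha>: "nat_trans S1 D I1 (func_comp S1 I2 \<Phi>) \<alpha>"
    and D: "category D" by (auto dest: functor_category)
  have "Comp D (Ident D (FObj I2 (FObj \<Phi> s))) (\<alpha> s) = \<alpha> s" if "s \<in> Obj S1" for s
    using Comp_Ident_left[OF D nat_trans_hom[OF \<alpha> that]] that by simp
  then have "vert_comp S1 D (whisker_right S1 (\<lambda>s\<in>Obj S2. Ident D (FObj I2 s)) \<Phi>) \<alpha> = \<alpha>"
    by (intro extensionalityI[OF _ nat_trans_extensional[OF \<alpha>]])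
      (auto simp: vert_comp_def whisker_right_def functor_Obj[OF \<Phi>])
  then show ?case
    using * by (simp add: func_comp_id_left[OF \<Phi>])
next
  case (5 A B E F m n k)
  obtain S1 I1 S2 I2 S3 I3 S4 I4 \<Phi> \<alpha> \<Psi> \<beta> X \<gamma> where *: "A = (S1, I1)" "B = (S2, I2)"
    "E = (S3, I3)" "F = (S4, I4)" "m = (\<Phi>, \<alpha>)" "n = (\<Psi>, \<beta>)" "k = (X, \<gamma>)"
    by (cases A; cases B; cases E; cases F; cases m; cases n; cases k)
  with 5 have \<Phi>: "is_functor S1 S2 \<Phi>" and \<alpha>: "nat_trans S1 D I1 (func_comp S1 I2 \<Phi>) \<alpha>"
    and \<Psi>: "is_functor S2 S3 \<Psi>" and \<beta>: "nat_trans S2 D I2 (func_comp S2 I3 \<Psi>) \<beta>"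
    and \<gamma>: "nat_trans S3 D I3 (func_comp S3 I4 X) \<gamma>"
    and D: "category D" by (auto dest: functor_category)
  have "Comp D (\<gamma> (FObj \<Psi> (FObj \<Phi> s))) (Comp D (\<beta> (FObj \<Phi> s)) (\<alpha> s)) =
      Comp D (Comp D (\<gamma> (FObj \<Psi> (FObj \<Phi> s))) (\<beta> (FObj \<Phi> s))) (\<alpha> s)" if s: "s \<in> Obj S1" for s
  proof (rule Comp_assoc[OF D])
    note \<Phi>s = functor_Obj[OF \<Phi> s]
    show "\<alpha> s \<in> hom D (FObj I1 s) (FObj I2 (FObj \<Phi> s))"
      using nat_trans_hom[OF \<alpha> s] s by simp
    show "\<beta> (FObj \<Phi> s) \<in> hom D (FObj I2 (FObj \<Phi> s)) (FObj I3 (FObj \<Psi> (FObj \<Phi> s)))"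
      using nat_trans_hom[OF \<beta> \<Phi>s] \<Phi>s by simp
    show "\<gamma> (FObj \<Psi> (FObj \<Phi> s)) \<in> hom D (FObj I3 (FObj \<Psi> (FObj \<Phi> s)))
        (FObj (func_comp S3 I4 X) (FObj \<Psi> (FObj \<Phi> s)))"
      by (rule nat_trans_hom[OF \<gamma> functor_Obj[OF \<Psi> \<Phi>s]])
  qed
  then have "vert_comp S1 D (whisker_right S1 \<gamma> (func_comp S1 \<Psi> \<Phi>))
        (vert_comp S1 D (whisker_right S1 \<beta> \<Phi>) \<alpha>) =
      vert_comp S1 D (whisker_right S1 (vert_comp S2 D (whisker_right S2 \<gamma> \<Psi>) \<beta>) \<Phi>) \<alpha>"
    by (auto simp: vert_comp_def whisker_right_def functor_Obj[OF \<Phi>] fun_eq_iff)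
  then show ?case
    using * func_comp_assoc[OF \<Phi>] by simp
qed

text \<open>
  Postcomposition of institutions with a functor out of \<open>D\<close>, leaving the signatures alone. Both
  \<open>ILoc\<close> and \<open>IE\<close> have this form.
\<close>

definition Inst_func ::
  "('p, 'b) cat \<Rightarrow> ('p, 'b, 'q, 'c) func \<Rightarrow>
    (('so, 'sa, 'p, 'b) inst, (('so, 'sa, 'p, 'b) inst, ('so, 'sa, 'b) inst_label) arrow,
     ('so, 'sa, 'q, 'c) inst, (('so, 'sa, 'q, 'c) inst, ('so, 'sa, 'c) inst_label) arrow) func"
  where
  "Inst_func D F =
     \<lparr>FObj = (\<lambda>(S, I) \<in> Obj (Inst D). (S, func_comp S F I)),
      FArr = (\<lambda>m \<in> Arr (Inst D). case m of Arrow (S1, I1) (\<Phi>, \<alpha>) (S2, I2) \<Rightarrow>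
        Arrow (S1, func_comp S1 F I1) (\<Phi>, whisker_left S1 F \<alpha>) (S2, func_comp S2 F I2))\<rparr>"

lemma Inst_func_Obj:
  "is_functor S D I \<Longrightarrow> FObj (Inst_func D F) (S, I) = (S, func_comp S F I)"
  by (simp add: Inst_func_def Inst_Obj)

lemma Inst_func_Arr:
  "Arrow (S1, I1) (\<Phi>, \<alpha>) (S2, I2) \<in> Arr (Inst D) \<Longrightarrow>
    FArr (Inst_func D F) (Arrow (S1, I1) (\<Phi>, \<alpha>) (S2, I2)) =
      Arrow (S1, func_comp S1 F I1) (\<Phi>, whisker_left S1 F \<alpha>) (S2, func_comp S2 F I2)"
  by (simp add: Inst_func_def)

lemma Inst_func_hom:
  "Arrow (S1, I1) (\<Phi>, \<alpha>) (S2, I2) \<in> hom (Inst D) P Q \<Longrightarrow>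
    FArr (Inst_func D F) (Arrow (S1, I1) (\<Phi>, \<alpha>) (S2, I2)) =
      Arrow (S1, func_comp S1 F I1) (\<Phi>, whisker_left S1 F \<alpha>) (S2, func_comp S2 F I2)"
  by (simp add: Inst_func_Arr hom_iff)

text \<open>
  Composition of institution morphisms is componentwise composition in \<open>D\<close>, with a reindexing along
  the signature functor. Applying \<open>F\<close> to components respects the former as \<open>F\<close> is a functor, and
  does not affect the latter.
\<close>

lemma functor_Inst_func:
  assumes F: "is_functor D D' F"
  shows "is_functor (Inst D) (Inst D') (Inst_func D F)"
proof (rule functorI[OF category_Inst category_Inst])
  show "FObj (Inst_func D F) \<in> extensional (Obj (Inst D))"
    "FArr (Inst_func D F) \<in> extensional (Arr (Inst D))"
    by (simp_all add: Inst_func_def)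
  show "FObj (Inst_func D F) P \<in> Obj (Inst D')" if "P \<in> Obj (Inst D)" for P
    using that by (cases P) (auto simp: Inst_Obj Inst_func_Obj intro: functor_func_comp[OF _ F])
  show hom: "FArr (Inst_func D F) h \<in> hom (Inst D') (FObj (Inst_func D F) P) (FObj (Inst_func D F) Q)"
    if h: "h \<in> hom (Inst D) P Q" for h P Q
    using h
  proof (cases rule: Inst_homE)
    case (1 S1 I1 S2 I2 \<Phi> \<alpha>)
    have "nat_trans S1 D' (func_comp S1 F I1) (func_comp S1 (func_comp S2 F I2) \<Phi>)
        (whisker_left S1 F \<alpha>)"
      using nat_trans_whisker_left[OF 1(7) F] by (simp add: func_comp_assoc[OF 1(6)])
    with 1 h show ?thesis
      by (auto simp: Inst_func_Obj Inst_func_hom intro!: Inst_homI functor_func_comp[OF _ F])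
  qed
  show "FArr (Inst_func D F) (Ident (Inst D) P) = Ident (Inst D') (FObj (Inst_func D F) P)"
    if "P \<in> Obj (Inst D)" for P
  proof (cases P)
    case (Pair S I)
    with that have I: "is_functor S D I" by (simp add: Inst_Obj)
    have "whisker_left S F (\<lambda>s \<in> Obj S. Ident D (FObj I s)) =
        (\<lambda>s \<in> Obj S. Ident D' (FObj (func_comp S F I) s))"
      by (auto simp: whisker_left_def functor_Ident[OF F functor_Obj[OF I]])
    then show ?thesis
      using Ident_hom[OF category_Inst that] Pair I functor_func_comp[OF I F]
      by (auto simp: Inst_Ident Inst_func_Obj Inst_func_hom)
  qed
  show "FArr (Inst_func D F) (Comp (Inst D) k h) =
      Comp (Inst D') (FArr (Inst_func D F) k) (FArr (Inst_func D F) h)"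
    if h: "h \<in> hom (Inst D) P Q" and k: "k \<in> hom (Inst D) Q R" for h k P Q R
    using h
  proof (cases rule: Inst_homE)
    case h': (1 S1 I1 S2 I2 \<Phi> \<alpha>)
    show ?thesis
      using k
    proof (cases rule: Inst_homE)
      case k': (1 S2' I2' S3 I3 \<Psi> \<beta>)
      have [simp]: "S2' = S2" "I2' = I2" using h' k' by auto
      note \<Phi> = h'(6) and \<alpha> = h'(7) and \<beta> = k'(7)[simplified]
      have comp: "Comp (Inst D) k h = Arrow (S1, I1)
          (func_comp S1 \<Psi> \<Phi>, vert_comp S1 D (whisker_right S1 \<beta> \<Phi>) \<alpha>) (S3, I3)"
        using h k h' k' by (simp add: Inst_Comp)
      have "FArr F (Comp D (\<beta> (FObj \<Phi> s)) (\<alpha> s)) =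
          Comp D' (FArr F (\<beta> (FObj \<Phi> s))) (FArr F (\<alpha> s))" if "s \<in> Obj S1" for s
        using functor_Comp[OF F _ nat_trans_hom[OF \<beta> functor_Obj[OF \<Phi> that]]]
          nat_trans_hom[OF \<alpha> that] that by simp
      then have "whisker_left S1 F (vert_comp S1 D (whisker_right S1 \<beta> \<Phi>) \<alpha>) =
          vert_comp S1 D' (whisker_right S1 (whisker_left S2 F \<beta>) \<Phi>) (whisker_left S1 F \<alpha>)"
        by (auto simp: whisker_left_def whisker_right_def vert_comp_def functor_Obj[OF \<Phi>])
      then show ?thesis
        using Comp_hom[OF category_Inst h k] hom[OF h] hom[OF k] h k h' k'
        by (simp add: comp Inst_func_hom Inst_func_Obj Inst_Comp)
    qed
  qed
qed

lemma Inst_func_id: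
  assumes D: "category D"
  shows "Inst_func D (id_func D) = id_func (Inst D)"
proof (rule functor_eqI)
  show "is_functor (Inst D) (Inst D) (Inst_func D (id_func D))"
    "is_functor (Inst D) (Inst D) (id_func (Inst D))"
    by (rule functor_Inst_func[OF functor_id_func[OF D]] functor_id_func[OF category_Inst])+
  show "FObj (Inst_func D (id_func D)) P = FObj (id_func (Inst D)) P" if "P \<in> Obj (Inst D)" for P
    using that by (cases P) (auto simp: Inst_Obj Inst_func_Obj func_comp_id_left)
  show "FArr (Inst_func D (id_func D)) h = FArr (id_func (Inst D)) h" if h: "h \<in> Arr (Inst D)" for h
    using in_own_hom[OF h]
  proof (cases rule: Inst_homE)
    case (1 S1 I1 S2 I2 \<Phi> \<alpha>)
    have "whisker_left S1 (id_func D) \<alpha> = \<alpha>"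
      by (rule extensionalityI[OF _ nat_trans_extensional[OF 1(7)]])
        (auto simp: whisker_left_def id_func_hom[OF nat_trans_hom[OF 1(7)]])
    with 1 h show ?thesis
      by (simp add: Inst_func_Arr func_comp_id_left)
  qed
qed

lemma Inst_func_comp:
  assumes F: "is_functor D D' F" and G: "is_functor D' D'' G"
  shows "Inst_func D (func_comp D G F) = func_comp (Inst D) (Inst_func D' G) (Inst_func D F)"
proof (rule functor_eqI)
  note IF = functor_Inst_func[OF F]
  show "is_functor (Inst D) (Inst D'') (Inst_func D (func_comp D G F))"
    "is_functor (Inst D) (Inst D'') (func_comp (Inst D) (Inst_func D' G) (Inst_func D F))"
    by (rule functor_Inst_func[OF functor_func_comp[OF F G]]
        functor_func_comp[OF IF functor_Inst_func[OF G]])+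
  show "FObj (Inst_func D (func_comp D G F)) P =
      FObj (func_comp (Inst D) (Inst_func D' G) (Inst_func D F)) P" if "P \<in> Obj (Inst D)" for P
    using that by (cases P)
      (auto simp: Inst_Obj Inst_func_Obj func_comp_assoc functor_func_comp[OF _ F])
  show "FArr (Inst_func D (func_comp D G F)) h =
      FArr (func_comp (Inst D) (Inst_func D' G) (Inst_func D F)) h" if h: "h \<in> Arr (Inst D)" for h
    using in_own_hom[OF h]
  proof (cases rule: Inst_homE)
    case (1 S1 I1 S2 I2 \<Phi> \<alpha>)
    have "whisker_left S1 (func_comp D G F) \<alpha> = whisker_left S1 G (whisker_left S1 F \<alpha>)"
      by (auto simp: whisker_left_def func_comp_hom[OF nat_trans_hom[OF 1(7)]])
    with 1 h functor_Arr[OF IF h] show ?thesis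
      by (simp add: Inst_func_Arr func_comp_assoc)
  qed
qed

text \<open>
  A functor \<open>I\<close> is recovered from \<open>F I\<close> since
  \<open>F\<close> is injective on objects and faithful. Fullness of \<open>F\<close> lifts a transformation between \<open>F I\<close> and
  \<open>F J\<close> componentwise, and faithfulness turns its naturality into that of the lift.
\<close>

lemma full_embedding_Inst_func:
  fixes D :: "('p, 'b) cat" and D' :: "('q, 'c) cat"
  assumes F: "full_embedding D D' F"
  shows "full_embedding (Inst D :: ('so, 'sa, 'p, 'b) inst_cat) (Inst D') (Inst_func D F)"
proof -
  note FF = full_embeddingD(1)[OF F]
  note D = functor_category(1)[OF FF] and D' = functor_category(2)[OF FF]
  have func_inj: "I = J" if I: "is_functor S D I" and J: "is_functor S D J"
    and eq: "func_comp S F I = func_comp S F J" for S :: "('so, 'sa) cat" and I J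
  proof (rule functor_eqI[OF I J])
    show obj: "FObj I s = FObj J s" if s: "s \<in> Obj S" for s
      using full_embeddingD(4)[OF F functor_Obj[OF I s] functor_Obj[OF J s]]
        func_comp_simps(1)[OF s, of F I] func_comp_simps(1)[OF s, of F J] eq by simp
    show "FArr I u = FArr J u" if u: "u \<in> Arr S" for u
    proof -
      note u' = in_own_hom[OF u]
      note ob = hom_Obj[OF functor_category(1)[OF I] u']
      show ?thesis
        using full_embeddingD(3)[OF F functor_hom[OF I u'], of "FArr J u"]
          functor_hom[OF J u'] obj ob
          func_comp_simps(2)[OF u, of F I] func_comp_simps(2)[OF u, of F J] eq by simp
    qed
  qed
  show ?thesis
  proof (rule full_embeddingI[OF functor_Inst_func[OF FF]])
    fix P Q :: "('so, 'sa, 'p, 'b) inst"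
    assume "P \<in> Obj (Inst D)" "Q \<in> Obj (Inst D)" "FObj (Inst_func D F) P = FObj (Inst_func D F) Q"
    then show "P = Q"
      by (cases P; cases Q) (auto simp: Inst_Obj Inst_func_Obj intro: func_inj)
  next
    fix P Q :: "('so, 'sa, 'p, 'b) inst" and h k
    assume h: "h \<in> hom (Inst D) P Q" and k: "k \<in> hom (Inst D) P Q"
      and eq: "FArr (Inst_func D F) h = FArr (Inst_func D F) k"
    show "h = k"
      using h
    proof (cases rule: Inst_homE)
      case h': (1 S1 I1 S2 I2 \<Phi> \<alpha>)
      then obtain \<Psi> \<beta> where k': "k = Arrow (S1, I1) (\<Psi>, \<beta>) (S2, I2)"
        "nat_trans S1 D I1 (func_comp S1 I2 \<Psi>) \<beta>"
        using k by (auto simp: Inst_hom)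
      have "\<Phi> = \<Psi>" and w: "whisker_left S1 F \<alpha> = whisker_left S1 F \<beta>"
        using eq h k h' k' by (simp_all add: Inst_func_hom)
      moreover have "\<alpha> = \<beta>"
      proof (rule extensionalityI[OF nat_trans_extensional[OF h'(7)] nat_trans_extensional[OF k'(2)]])
        fix s assume s: "s \<in> Obj S1"
        have "FArr F (\<alpha> s) = FArr F (\<beta> s)"
          using fun_cong[OF w, of s] s by (simp add: whisker_left_def)
        then show "\<alpha> s = \<beta> s"
          using full_embeddingD(3)[OF F nat_trans_hom[OF h'(7) s]] nat_trans_hom[OF k'(2) s] \<open>\<Phi> = \<Psi>\<close>
          by simp
      qed
      ultimately show ?thesis
        using h' k' by simp
    qed
  next
    fix P Q :: "('so, 'sa, 'p, 'b) inst" and g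
    assume P: "P \<in> Obj (Inst D)" and Q: "Q \<in> Obj (Inst D)"
      and g: "g \<in> hom (Inst D') (FObj (Inst_func D F) P) (FObj (Inst_func D F) Q)"
    obtain S1 I1 S2 I2 where PQ: "P = (S1, I1)" "Q = (S2, I2)"
      by (cases P; cases Q)
    with P Q have I1: "is_functor S1 D I1" and I2: "is_functor S2 D I2"
      by (simp_all add: Inst_Obj)
    obtain \<Phi> \<beta> where g': "g = Arrow (S1, func_comp S1 F I1) (\<Phi>, \<beta>) (S2, func_comp S2 F I2)"
      and \<Phi>: "is_functor S1 S2 \<Phi>"
      and "nat_trans S1 D' (func_comp S1 F I1) (func_comp S1 (func_comp S2 F I2) \<Phi>) \<beta>"
      using g PQ I1 I2 by (auto simp: Inst_func_Obj Inst_hom)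
    then have \<beta>: "nat_trans S1 D' (func_comp S1 F I1) (func_comp S1 F (func_comp S1 I2 \<Phi>)) \<beta>"
      by (simp add: func_comp_assoc[OF \<Phi>])
    define J where "J = func_comp S1 I2 \<Phi>"
    have J: "is_functor S1 D J"
      unfolding J_def by (rule functor_func_comp[OF \<Phi> I2])
    note S1 = functor_category(1)[OF I1]
    have "\<forall>s \<in> Obj S1. \<exists>a. a \<in> hom D (FObj I1 s) (FObj J s) \<and> \<beta> s = FArr F a"
    proof
      fix s assume s: "s \<in> Obj S1"
      show "\<exists>a. a \<in> hom D (FObj I1 s) (FObj J s) \<and> \<beta> s = FArr F a"
        using full_embeddingD(2)[OF F functor_Obj[OF I1 s] functor_Obj[OF J s], of "\<beta> s"]
          nat_trans_hom[OF \<beta> s] s by (auto simp: J_def)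
    qed
    then obtain \<alpha>0 where \<alpha>0: "\<forall>s \<in> Obj S1. \<alpha>0 s \<in> hom D (FObj I1 s) (FObj J s) \<and> \<beta> s = FArr F (\<alpha>0 s)"
      by (rule bchoice[THEN exE])
    \<comment> \<open>The chosen components are arbitrary outside \<open>Obj S1\<close>, where a natural transformation must be
      \<open>undefined\<close>.\<close>
    define \<alpha> where "\<alpha> = restrict \<alpha>0 (Obj S1)"
    have \<alpha>: "\<alpha> s \<in> hom D (FObj I1 s) (FObj J s)" "FArr F (\<alpha> s) = \<beta> s" if "s \<in> Obj S1" for s
      using that \<alpha>0 by (simp_all add: \<alpha>_def)
    have nat: "nat_trans S1 D I1 J \<alpha>"
    proof (rule nat_transI[OF I1 J])
      show "Comp D (FArr J u) (\<alpha> s) = Comp D (\<alpha> t) (FArr I1 u)" if u: "u \<in> hom S1 s t" for u s t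
      proof (rule full_embeddingD(3)[OF F])
        note s = hom_Obj(1)[OF S1 u] and t = hom_Obj(2)[OF S1 u]
        show "Comp D (FArr J u) (\<alpha> s) \<in> hom D (FObj I1 s) (FObj J t)"
          "Comp D (\<alpha> t) (FArr I1 u) \<in> hom D (FObj I1 s) (FObj J t)"
          by (rule Comp_hom[OF D \<alpha>(1)[OF s] functor_hom[OF J u]]
              Comp_hom[OF D functor_hom[OF I1 u] \<alpha>(1)[OF t]])+
        show "FArr F (Comp D (FArr J u) (\<alpha> s)) = FArr F (Comp D (\<alpha> t) (FArr I1 u))"
          using nat_trans_natural[OF \<beta>[folded J_def] u] u \<alpha>(2)[OF s] \<alpha>(2)[OF t]
          by (simp add: functor_Comp[OF FF \<alpha>(1)[OF s] functor_hom[OF J u]]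
              functor_Comp[OF FF functor_hom[OF I1 u] \<alpha>(1)[OF t]])
      qed
    qed (simp_all add: \<alpha> , simp add: \<alpha>_def)
    have "whisker_left S1 F \<alpha> = \<beta>"
      by (rule extensionalityI[OF _ nat_trans_extensional[OF \<beta>]]) (auto simp: whisker_left_def \<alpha>)
    moreover have "Arrow (S1, I1) (\<Phi>, \<alpha>) (S2, I2) \<in> hom (Inst D) P Q"
      unfolding PQ using nat unfolding J_def by (rule Inst_homI[OF I2 \<Phi>])
    ultimately show "\<exists>f \<in> hom (Inst D) P Q. g = FArr (Inst_func D F) f"
      using g' Inst_func_hom by metis
  qed
qed

text \<open>
  A natural transformation between base functors acts on institutions through morphisms whose
  signature part is the identity. This completes the action of \<open>Inst\<close> on functors to a 2-functor.
\<close>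

definition Inst_nat ::
  "('p, 'b) cat \<Rightarrow> ('p, 'b, 'q, 'c) func \<Rightarrow> ('p, 'b, 'q, 'c) func \<Rightarrow> ('p \<Rightarrow> 'c) \<Rightarrow>
    ('so, 'sa, 'p, 'b) inst \<Rightarrow> (('so, 'sa, 'q, 'c) inst, ('so, 'sa, 'c) inst_label) arrow" where
  "Inst_nat D F G \<alpha> = (\<lambda>(S, I) \<in> Obj (Inst D).
     Arrow (S, func_comp S F I) (id_func S, whisker_right S \<alpha> I) (S, func_comp S G I))"

lemma Inst_nat_component:
  "is_functor S D I \<Longrightarrow> Inst_nat D F G \<alpha> (S, I) =
    Arrow (S, func_comp S F I) (id_func S, whisker_right S \<alpha> I) (S, func_comp S G I)"
  by (simp add: Inst_nat_def Inst_Obj)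

text \<open>
  Naturality against an institution morphism with transformation \<open>\<beta>\<close> is the naturality of \<open>\<alpha>\<close> at
  each component of \<open>\<beta>\<close>.
\<close>

lemma nat_trans_Inst_nat:
  assumes \<alpha>: "nat_trans D D' F G \<alpha>"
  shows "nat_trans (Inst D) (Inst D') (Inst_func D F) (Inst_func D G) (Inst_nat D F G \<alpha>)"
proof -
  note F = nat_trans_functors(1)[OF \<alpha>] and G = nat_trans_functors(2)[OF \<alpha>]
  note IF = functor_Inst_func[OF F] and IG = functor_Inst_func[OF G]
  have hom: "Arrow (S, func_comp S F I) (id_func S, whisker_right S \<alpha> I) (S, func_comp S G I) \<in>
      hom (Inst D') (S, func_comp S F I) (S, func_comp S G I)" if I: "is_functor S D I" for S I
  proof (rule Inst_homI)
    show "is_functor S D' (func_comp S G I)"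
      by (rule functor_func_comp[OF I G])
    show "is_functor S S (id_func S)"
      by (rule functor_id_func[OF functor_category(1)[OF I]])
    show "nat_trans S D' (func_comp S F I) (func_comp S (func_comp S G I) (id_func S))
        (whisker_right S \<alpha> I)"
      using nat_trans_whisker_right[OF \<alpha> I]
      by (simp add: func_comp_id_right[OF functor_func_comp[OF I G]])
  qed
  show ?thesis
  proof (rule nat_transI[OF IF IG])
    show "Inst_nat D F G \<alpha> \<in> extensional (Obj (Inst D))"
      by (simp add: Inst_nat_def)
    show "Inst_nat D F G \<alpha> P \<in> hom (Inst D') (FObj (Inst_func D F) P) (FObj (Inst_func D G) P)"
      if "P \<in> Obj (Inst D)" for P
      using that hom by (cases P) (auto simp: Inst_Obj Inst_func_Obj Inst_nat_component)
    show "Comp (Inst D') (FArr (Inst_func D G) h) (Inst_nat D F G \<alpha> P) =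
        Comp (Inst D') (Inst_nat D F G \<alpha> Q) (FArr (Inst_func D F) h)"
      if h: "h \<in> hom (Inst D) P Q" for h P Q
      using h
    proof (cases rule: Inst_homE)
      case (1 S1 I1 S2 I2 \<Phi> \<beta>)
      note \<Phi> = 1(6) and \<beta> = 1(7)
      note S1 = functor_category(1)[OF 1(4)]
      have "Comp D' (FArr G (\<beta> s)) (\<alpha> (FObj I1 s)) =
          Comp D' (\<alpha> (FObj I2 (FObj \<Phi> s))) (FArr F (\<beta> s))" if "s \<in> Obj S1" for s
        using nat_trans_natural[OF \<alpha> nat_trans_hom[OF \<beta> that]] that by simp
      then have "vert_comp S1 D' (whisker_right S1 (whisker_left S1 G \<beta>) (id_func S1))
            (whisker_right S1 \<alpha> I1) =
          vert_comp S1 D' (whisker_right S1 (whisker_right S2 \<alpha> I2) \<Phi>) (whisker_left S1 F \<beta>)"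
        by (auto simp: vert_comp_def whisker_left_def whisker_right_def functor_Obj[OF \<Phi>])
      then show ?thesis
        using 1 h hom[OF 1(4)] hom[OF 1(5)] functor_hom[OF IF h] functor_hom[OF IG h]
          func_comp_id_right[OF \<Phi>] func_comp_id_left[OF \<Phi>]
        by (simp add: Inst_nat_component Inst_func_hom Inst_func_Obj Inst_Comp)
    qed
  qed
qed

text \<open>
  Functoriality of \<open>Inst\<close> puts the induced unit and counit into the required form, and the triangle
  identities hold because they hold at the value of the institution at each signature.
\<close>

lemma adjoint_situation_Inst:
  fixes D :: "('p, 'b) cat" and E :: "('q, 'c) cat"
  assumes adj: "adjoint_situation D E L R \<eta> \<epsilon>"
  shows "adjoint_situation (Inst D :: ('so, 'sa, 'p, 'b) inst_cat) (Inst E) (Inst_func D L) (Inst_func E R)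
    (Inst_nat D (id_func D) (func_comp D R L) \<eta>) (Inst_nat E (func_comp E L R) (id_func E) \<epsilon>)"
proof -
  note L = adjoint_situationD(1)[OF adj] and R = adjoint_situationD(2)[OF adj]
  note \<eta> = adjoint_situationD(3)[OF adj] and \<epsilon> = adjoint_situationD(4)[OF adj]
  note D = functor_category(1)[OF L] and E = functor_category(2)[OF L]
  note IL = functor_Inst_func[OF L] and IR = functor_Inst_func[OF R]
  let ?\<eta> = "Inst_nat D (id_func D) (func_comp D R L) \<eta> :: ('so, 'sa, 'p, 'b) inst \<Rightarrow> _"
  let ?\<epsilon> = "Inst_nat E (func_comp E L R) (id_func E) \<epsilon> :: ('so, 'sa, 'q, 'c) inst \<Rightarrow> _"
  have \<eta>': "nat_trans (Inst D) (Inst D) (id_func (Inst D))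
      (func_comp (Inst D) (Inst_func E R) (Inst_func D L)) ?\<eta>"
    using nat_trans_Inst_nat[OF \<eta>] by (simp add: Inst_func_id[OF D] Inst_func_comp[OF L R])
  have \<epsilon>': "nat_trans (Inst E) (Inst E) (func_comp (Inst E) (Inst_func D L) (Inst_func E R))
      (id_func (Inst E)) ?\<epsilon>"
    using nat_trans_Inst_nat[OF \<epsilon>] by (simp add: Inst_func_id[OF E] Inst_func_comp[OF R L])
  have "Comp (Inst E) (?\<epsilon> (FObj (Inst_func D L) P)) (FArr (Inst_func D L) (?\<eta> P)) =
      Ident (Inst E) (FObj (Inst_func D L) P)" if P: "P \<in> Obj (Inst D)" for P
  proof (cases P)
    case (Pair S I)
    then have I: "is_functor S D I" using P by (simp add: Inst_Obj)
    note S = functor_category(1)[OF I]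
    note LI = functor_func_comp[OF I L]
    note RLI = functor_func_comp[OF LI R]
    have "vert_comp S E (whisker_right S (whisker_right S \<epsilon> (func_comp S L I)) (id_func S))
        (whisker_left S L (whisker_right S \<eta> I)) = (\<lambda>s \<in> Obj S. Ident E (FObj (func_comp S L I) s))"
      using adjoint_situationD(5)[OF adj] functor_Obj[OF I]
      by (auto simp: vert_comp_def whisker_left_def whisker_right_def)
    then show ?thesis
      using Pair I LI RLI nat_trans_hom[OF \<eta>' P] functor_hom[OF IL nat_trans_hom[OF \<eta>' P]]
        nat_trans_hom[OF \<epsilon>' functor_Obj[OF IL P]] functor_Obj[OF IL P] P
      by (simp add: Inst_nat_component Inst_func_Obj Inst_func_hom Inst_Comp Inst_Ident
          func_comp_id_left func_comp_id_right[OF functor_id_func[OF S]]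
          func_comp_assoc[OF I, symmetric] func_comp_assoc[OF LI, symmetric])
  qed
  moreover have "Comp (Inst D) (FArr (Inst_func E R) (?\<epsilon> P)) (?\<eta> (FObj (Inst_func E R) P)) =
      Ident (Inst D) (FObj (Inst_func E R) P)" if P: "P \<in> Obj (Inst E)" for P
  proof (cases P)
    case (Pair S I)
    then have I: "is_functor S E I" using P by (simp add: Inst_Obj)
    note S = functor_category(1)[OF I]
    note RI = functor_func_comp[OF I R]
    note LRI = functor_func_comp[OF RI L]
    have "vert_comp S D (whisker_right S (whisker_left S R (whisker_right S \<epsilon> I)) (id_func S))
        (whisker_right S \<eta> (func_comp S R I)) = (\<lambda>s \<in> Obj S. Ident D (FObj (func_comp S R I) s))"
      using adjoint_situationD(6)[OF adj] functor_Obj[OF I]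
      by (auto simp: vert_comp_def whisker_left_def whisker_right_def)
    then show ?thesis
      using Pair I RI LRI nat_trans_hom[OF \<epsilon>' P] functor_hom[OF IR nat_trans_hom[OF \<epsilon>' P]]
        nat_trans_hom[OF \<eta>' functor_Obj[OF IR P]] functor_Obj[OF IR P] P
      by (simp add: Inst_nat_component Inst_func_Obj Inst_func_hom Inst_Comp Inst_Ident
          func_comp_id_left func_comp_id_right[OF functor_id_func[OF S]]
          func_comp_assoc[OF I, symmetric] func_comp_assoc[OF RI, symmetric])
  qed
  ultimately show ?thesis
    using IL IR \<eta>' \<epsilon>' by (simp add: adjoint_situation_def)
qed


section \<open>Affine systems and their localic part\<close>

lemma AfSys_Obj:
  "(x, \<kappa>, b) \<in> Obj (AfSys X D T) \<longleftrightarrow> x \<in> Obj X \<and> b \<in> Obj D \<and> \<kappa> \<in> hom D (FObj T x) b"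
  by (simp add: AfSys_def)

lemma AfSys_hom:
  "h \<in> hom (AfSys X D T) (x1, \<kappa>1, b1) (x2, \<kappa>2, b2) \<longleftrightarrow>
    (x1, \<kappa>1, b1) \<in> Obj (AfSys X D T) \<and> (x2, \<kappa>2, b2) \<in> Obj (AfSys X D T) \<and>
    (\<exists>f \<phi>. h = Arrow (x1, \<kappa>1, b1) (f, \<phi>) (x2, \<kappa>2, b2) \<and>
      f \<in> hom X x1 x2 \<and> \<phi> \<in> hom D b1 b2 \<and> Comp D \<kappa>2 (FArr T f) = Comp D \<phi> \<kappa>1)"
  by (auto simp: AfSys_def hom_cat_hom)

lemma AfSys_homE:
  assumes "h \<in> hom (AfSys X D T) P Q"
  obtains x1 \<kappa>1 b1 x2 \<kappa>2 b2 f \<phi> where "P = (x1, \<kappa>1, b1)" "Q = (x2, \<kappa>2, b2)"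
    "h = Arrow (x1, \<kappa>1, b1) (f, \<phi>) (x2, \<kappa>2, b2)"
    "(x1, \<kappa>1, b1) \<in> Obj (AfSys X D T)" "(x2, \<kappa>2, b2) \<in> Obj (AfSys X D T)"
    "f \<in> hom X x1 x2" "\<phi> \<in> hom D b1 b2" "Comp D \<kappa>2 (FArr T f) = Comp D \<phi> \<kappa>1"
  using assms by (cases P; cases Q) (auto simp: AfSys_hom)

lemma AfSys_Ident:
  "(x, \<kappa>, b) \<in> Obj (AfSys X D T) \<Longrightarrow> Ident (AfSys X D T) (x, \<kappa>, b) =
    Arrow (x, \<kappa>, b) (Ident X x, Ident D b) (x, \<kappa>, b)"
  by (simp add: AfSys_def)

lemma AfSys_Comp:
  assumes "Arrow P (f, \<phi>) Q \<in> hom (AfSys X D T) P Q" "Arrow Q (g, \<psi>) R \<in> hom (AfSys X D T) Q R"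
  shows "Comp (AfSys X D T) (Arrow Q (g, \<psi>) R) (Arrow P (f, \<phi>) Q) =
    Arrow P (Comp X g f, Comp D \<psi> \<phi>) R"
  using assms unfolding AfSys_def by (subst hom_cat_Comp) (auto simp: hom_cat_hom)

text \<open>
  Composites of system morphisms are again system morphisms by pasting the two commuting squares.
\<close>

lemma category_AfSys:
  assumes T: "is_functor X D T"
  shows "category (AfSys X D T)"
  unfolding AfSys_def
proof (rule category_hom_cat, goal_cases)
  note X = functor_category(1)[OF T] and D = functor_category(2)[OF T]
  case (1 A)
  then show ?case
    by (auto simp: Ident_hom[OF X] Ident_hom[OF D] functor_Ident[OF T] Comp_Ident_left[OF D]
        Comp_Ident_right[OF D])
next
  note X = functor_category(1)[OF T] and D = functor_category(2)[OF T]
  case (2 A B E m n)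
  obtain x1 \<kappa>1 b1 x2 \<kappa>2 b2 x3 \<kappa>3 b3 f \<phi> g \<psi> where *: "A = (x1, \<kappa>1, b1)" "B = (x2, \<kappa>2, b2)"
    "E = (x3, \<kappa>3, b3)" "m = (f, \<phi>)" "n = (g, \<psi>)"
    by (cases A; cases B; cases E; cases m; cases n)
  with 2 have \<kappa>: "\<kappa>1 \<in> hom D (FObj T x1) b1" "\<kappa>2 \<in> hom D (FObj T x2) b2"
      "\<kappa>3 \<in> hom D (FObj T x3) b3"
    and f: "f \<in> hom X x1 x2" "g \<in> hom X x2 x3"
    and \<phi>: "\<phi> \<in> hom D b1 b2" "\<psi> \<in> hom D b2 b3"
    and eq: "Comp D \<kappa>2 (FArr T f) = Comp D \<phi> \<kappa>1" "Comp D \<kappa>3 (FArr T g) = Comp D \<psi> \<kappa>2"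
    by auto
  note Tf = functor_hom[OF T f(1)] and Tg = functor_hom[OF T f(2)]
  have "Comp D \<kappa>3 (FArr T (Comp X g f)) = Comp D (Comp D \<kappa>3 (FArr T g)) (FArr T f)"
    by (simp add: functor_Comp[OF T f] Comp_assoc[OF D Tf Tg \<kappa>(3)])
  also have "\<dots> = Comp D \<psi> (Comp D \<kappa>2 (FArr T f))"
    by (simp add: eq(2) Comp_assoc[OF D Tf \<kappa>(2) \<phi>(2)])
  also have "\<dots> = Comp D (Comp D \<psi> \<phi>) \<kappa>1"
    by (simp add: eq(1) Comp_assoc[OF D \<kappa>(1) \<phi>])
  finally show ?case
    using * Comp_hom[OF X f] Comp_hom[OF D \<phi>] by simp
next
  case (3 A B m)
  then show ?case
    by (auto simp: Comp_Ident_right[OF functor_category(1)[OF T]]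
        Comp_Ident_right[OF functor_category(2)[OF T]])
next
  case (4 A B m)
  then show ?case
    by (auto simp: Comp_Ident_left[OF functor_category(1)[OF T]]
        Comp_Ident_left[OF functor_category(2)[OF T]])
next
  case (5 A B E F m n k)
  then show ?case
    by (auto simp: Comp_assoc[OF functor_category(1)[OF T]]
        Comp_assoc[OF functor_category(2)[OF T]])
qed

lemma Loc_func_Obj: "(x, \<kappa>, b) \<in> Obj (AfSys X D T) \<Longrightarrow> FObj (Loc_func X D T) (x, \<kappa>, b) = b"
  by (simp add: Loc_func_def)

lemma Loc_func_hom:
  "Arrow P (f, \<phi>) Q \<in> hom (AfSys X D T) P' Q' \<Longrightarrow> FArr (Loc_func X D T) (Arrow P (f, \<phi>) Q) = \<phi>"
  by (simp add: Loc_func_def hom_iff)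

lemma functor_Loc_func:
  assumes T: "is_functor X D T"
  shows "is_functor (AfSys X D T) D (Loc_func X D T)"
proof -
  note X = functor_category(1)[OF T] and D = functor_category(2)[OF T]
  note A = category_AfSys[OF T]
  show ?thesis
  proof (rule functorI[OF A D])
    show "FObj (Loc_func X D T) \<in> extensional (Obj (AfSys X D T))"
      "FArr (Loc_func X D T) \<in> extensional (Arr (AfSys X D T))"
      by (simp_all add: Loc_func_def)
    show "FObj (Loc_func X D T) P \<in> Obj D" if "P \<in> Obj (AfSys X D T)" for P
      using that by (cases P) (auto simp: Loc_func_Obj AfSys_Obj)
    show "FArr (Loc_func X D T) h \<in> hom D (FObj (Loc_func X D T) P) (FObj (Loc_func X D T) Q)"
      if h: "h \<in> hom (AfSys X D T) P Q" for h P Q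
      using h by (cases rule: AfSys_homE) (use h in \<open>auto simp: Loc_func_Obj Loc_func_hom\<close>)
    show "FArr (Loc_func X D T) (Ident (AfSys X D T) P) = Ident D (FObj (Loc_func X D T) P)"
      if P: "P \<in> Obj (AfSys X D T)" for P
      using P Ident_hom[OF A P] by (cases P) (simp add: AfSys_Ident Loc_func_Obj Loc_func_hom)
    show "FArr (Loc_func X D T) (Comp (AfSys X D T) k h) =
        Comp D (FArr (Loc_func X D T) k) (FArr (Loc_func X D T) h)"
      if h: "h \<in> hom (AfSys X D T) P Q" and k: "k \<in> hom (AfSys X D T) Q R" for h k P Q R
    proof -
      obtain f \<phi> where h': "h = Arrow P (f, \<phi>) Q" using h by (auto elim: AfSys_homE)
      obtain g \<psi> where k': "k = Arrow Q (g, \<psi>) R" using k by (auto elim: AfSys_homE)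
      show ?thesis
        using h k Comp_hom[OF A h k] by (simp add: h' k' AfSys_Comp Loc_func_hom)
    qed
  qed
qed

context
  fixes X :: "('xo, 'xa) cat" and D :: "('do, 'da) cat" and T Pt \<eta> \<epsilon>
  assumes adj: "adjoint_situation X D T Pt \<eta> \<epsilon>"
begin

private lemmas T = adjoint_situationD(1)[OF adj]
private lemmas Pt = adjoint_situationD(2)[OF adj]
private lemmas X = functor_category(1)[OF T]
private lemmas D = functor_category(2)[OF T]

private lemma unit_hom: "x \<in> Obj X \<Longrightarrow> \<eta> x \<in> hom X x (FObj Pt (FObj T x))"
  using nat_trans_hom[OF adjoint_situationD(3)[OF adj]] by fastforce

private lemma counit_hom: "b \<in> Obj D \<Longrightarrow> \<epsilon> b \<in> hom D (FObj T (FObj Pt b)) b"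
  using nat_trans_hom[OF adjoint_situationD(4)[OF adj]] by fastforce

private lemma unit_natural:
  "f \<in> hom X x y \<Longrightarrow> Comp X (FArr Pt (FArr T f)) (\<eta> x) = Comp X (\<eta> y) f"
  using nat_trans_natural[OF adjoint_situationD(3)[OF adj]] by fastforce

private lemma counit_natural:
  "\<phi> \<in> hom D a b \<Longrightarrow> Comp D \<phi> (\<epsilon> a) = Comp D (\<epsilon> b) (FArr T (FArr Pt \<phi>))"
  using nat_trans_natural[OF adjoint_situationD(4)[OF adj]] by fastforce

text \<open>
  This and the next lemma say that \<open>\<kappa> \<mapsto> Pt \<kappa> \<circ> \<eta>\<^sub>x\<close> and \<open>f \<mapsto> \<epsilon>\<^sub>b \<circ> T f\<close> are mutually inverse bijections
  between the arrows \<open>T x \<rightarrow> b\<close> and the arrows \<open>x \<rightarrow> Pt b\<close>.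
\<close>

private lemma counit_transpose:
  assumes x: "x \<in> Obj X" and \<kappa>: "\<kappa> \<in> hom D (FObj T x) b"
  shows "Comp D (\<epsilon> b) (FArr T (Comp X (FArr Pt \<kappa>) (\<eta> x))) = \<kappa>"
proof -
  note b = hom_Obj(2)[OF D \<kappa>] and Tx = functor_Obj[OF T x]
  note Pt\<kappa> = functor_hom[OF Pt \<kappa>]
  note TPt\<kappa> = functor_hom[OF T Pt\<kappa>] and T\<eta> = functor_hom[OF T unit_hom[OF x]]
  have "Comp D (\<epsilon> b) (FArr T (Comp X (FArr Pt \<kappa>) (\<eta> x))) =
      Comp D (Comp D (\<epsilon> b) (FArr T (FArr Pt \<kappa>))) (FArr T (\<eta> x))"
    by (simp add: functor_Comp[OF T unit_hom[OF x] Pt\<kappa>]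
        Comp_assoc[OF D T\<eta> TPt\<kappa> counit_hom[OF b]])
  also have "\<dots> = Comp D \<kappa> (Comp D (\<epsilon> (FObj T x)) (FArr T (\<eta> x)))"
    by (simp add: counit_natural[OF \<kappa>, symmetric] Comp_assoc[OF D T\<eta> counit_hom[OF Tx] \<kappa>])
  also have "\<dots> = \<kappa>"
    by (simp add: adjoint_situationD(5)[OF adj x] Comp_Ident_right[OF D \<kappa>])
  finally show ?thesis .
qed

private lemma transpose_counit:
  assumes f: "f \<in> hom X x (FObj Pt b)" and b: "b \<in> Obj D"
  shows "Comp X (FArr Pt (Comp D (\<epsilon> b) (FArr T f))) (\<eta> x) = f"
proof -
  note x = hom_Obj(1)[OF X f] and Ptb = functor_Obj[OF Pt b]
  note Tf = functor_hom[OF T f]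
  note PtTf = functor_hom[OF Pt Tf] and Pt\<epsilon> = functor_hom[OF Pt counit_hom[OF b]]
  have "Comp X (FArr Pt (Comp D (\<epsilon> b) (FArr T f))) (\<eta> x) =
      Comp X (FArr Pt (\<epsilon> b)) (Comp X (FArr Pt (FArr T f)) (\<eta> x))"
    by (simp add: functor_Comp[OF Pt Tf counit_hom[OF b]]
        Comp_assoc[OF X unit_hom[OF x] PtTf Pt\<epsilon>])
  also have "\<dots> = Comp X (Comp X (FArr Pt (\<epsilon> b)) (\<eta> (FObj Pt b))) f"
    by (simp add: unit_natural[OF f] Comp_assoc[OF X f unit_hom[OF Ptb] Pt\<epsilon>])
  also have "\<dots> = f"
    by (simp add: adjoint_situationD(6)[OF adj b] Comp_Ident_left[OF X f])
  finally show ?thesis .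
qed

lemma E_func_Obj: "b \<in> Obj D \<Longrightarrow> FObj (E_func D Pt \<epsilon>) b = (FObj Pt b, \<epsilon> b, b)"
  by (simp add: E_func_def)

lemma E_func_hom:
  "\<phi> \<in> hom D a b \<Longrightarrow> FArr (E_func D Pt \<epsilon>) \<phi> =
    Arrow (FObj Pt a, \<epsilon> a, a) (FArr Pt \<phi>, \<phi>) (FObj Pt b, \<epsilon> b, b)"
  by (simp add: E_func_def hom_iff)

private lemma E_func_Obj_AfSys: "b \<in> Obj D \<Longrightarrow> (FObj Pt b, \<epsilon> b, b) \<in> Obj (AfSys X D T)"
  by (simp add: AfSys_Obj counit_hom functor_Obj[OF Pt])

private lemma E_func_AfSys_hom:
  assumes "\<phi> \<in> hom D a b"
  shows "Arrow (FObj Pt a, \<epsilon> a, a) (FArr Pt \<phi>, \<phi>) (FObj Pt b, \<epsilon> b, b) \<in>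
    hom (AfSys X D T) (FObj Pt a, \<epsilon> a, a) (FObj Pt b, \<epsilon> b, b)"
  using assms hom_Obj[OF D assms] functor_hom[OF Pt assms]
  by (simp add: AfSys_hom E_func_Obj_AfSys counit_natural)

lemma functor_E_func: "is_functor D (AfSys X D T) (E_func D Pt \<epsilon>)"
proof (rule functorI[OF D category_AfSys[OF T]])
  show "FObj (E_func D Pt \<epsilon>) \<in> extensional (Obj D)" "FArr (E_func D Pt \<epsilon>) \<in> extensional (Arr D)"
    by (simp_all add: E_func_def)
  show "FObj (E_func D Pt \<epsilon>) b \<in> Obj (AfSys X D T)" if "b \<in> Obj D" for b
    using that by (simp add: E_func_Obj E_func_Obj_AfSys)
  show "FArr (E_func D Pt \<epsilon>) \<phi> \<in>
      hom (AfSys X D T) (FObj (E_func D Pt \<epsilon>) a) (FObj (E_func D Pt \<epsilon>) b)"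
    if "\<phi> \<in> hom D a b" for \<phi> a b
    using E_func_AfSys_hom[OF that] hom_Obj[OF D that] that by (simp add: E_func_Obj E_func_hom)
  show "FArr (E_func D Pt \<epsilon>) (Ident D b) = Ident (AfSys X D T) (FObj (E_func D Pt \<epsilon>) b)"
    if "b \<in> Obj D" for b
    using that by (simp add: E_func_Obj E_func_hom[OF Ident_hom[OF D]] AfSys_Ident
        E_func_Obj_AfSys functor_Ident[OF Pt])
  show "FArr (E_func D Pt \<epsilon>) (Comp D \<psi> \<phi>) =
      Comp (AfSys X D T) (FArr (E_func D Pt \<epsilon>) \<psi>) (FArr (E_func D Pt \<epsilon>) \<phi>)"
    if "\<phi> \<in> hom D a b" "\<psi> \<in> hom D b c" for \<phi> \<psi> a b c
    by (simp add: E_func_hom[OF that(1)] E_func_hom[OF that(2)] E_func_hom[OF Comp_hom[OF D that]]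
        AfSys_Comp[OF E_func_AfSys_hom[OF that(1)] E_func_AfSys_hom[OF that(2)]]
        functor_Comp[OF Pt that])
qed

text \<open>
  A system morphism \<open>(f, \<phi>)\<close> from \<open>E a\<close> to \<open>E b\<close> satisfies \<open>\<epsilon>\<^sub>b \<circ> T f = \<phi> \<circ> \<epsilon>\<^sub>a\<close>, and by naturality of the
  counit so does \<open>(Pt \<phi>, \<phi>)\<close>. Hence \<open>f\<close> and \<open>Pt \<phi>\<close> have the same transpose and are equal.
  Injectivity on objects and arrows is clear since \<open>E\<close> keeps \<open>b\<close> and \<open>\<phi>\<close> as components.
\<close>

lemma full_embedding_E_func: "full_embedding D (AfSys X D T) (E_func D Pt \<epsilon>)"
proof (rule full_embeddingI[OF functor_E_func])
  show "\<exists>\<phi> \<in> hom D a b. h = FArr (E_func D Pt \<epsilon>) \<phi>"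
    if a: "a \<in> Obj D" and b: "b \<in> Obj D"
      and h: "h \<in> hom (AfSys X D T) (FObj (E_func D Pt \<epsilon>) a) (FObj (E_func D Pt \<epsilon>) b)" for a b h
  proof -
    obtain f \<phi> where h': "h = Arrow (FObj Pt a, \<epsilon> a, a) (f, \<phi>) (FObj Pt b, \<epsilon> b, b)"
      and f: "f \<in> hom X (FObj Pt a) (FObj Pt b)" and \<phi>: "\<phi> \<in> hom D a b"
      and eq: "Comp D (\<epsilon> b) (FArr T f) = Comp D \<phi> (\<epsilon> a)"
      using h a b by (auto simp: E_func_Obj AfSys_hom)
    have "f = Comp X (FArr Pt (Comp D (\<epsilon> b) (FArr T f))) (\<eta> (FObj Pt a))"
      by (rule transpose_counit[OF f b, symmetric])
    also have "\<dots> = FArr Pt \<phi>"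
      using transpose_counit[OF functor_hom[OF Pt \<phi>] b] counit_natural[OF \<phi>] by (simp add: eq)
    finally show ?thesis
      using \<phi> by (intro bexI[OF _ \<phi>]) (simp add: h' E_func_hom[OF \<phi>])
  qed
qed (auto simp: E_func_Obj E_func_hom)

text \<open>
  The first component is the transpose of \<open>\<kappa>\<close> under the given adjunction, the only choice that forms a
  system morphism to \<open>E b\<close> with the identity of \<open>b\<close>.
\<close>

definition sys_unit :: "'xo \<times> 'da \<times> 'do \<Rightarrow> ('xo \<times> 'da \<times> 'do, 'xa \<times> 'da) arrow" where
  "sys_unit = (\<lambda>(x, \<kappa>, b) \<in> Obj (AfSys X D T).
     Arrow (x, \<kappa>, b) (Comp X (FArr Pt \<kappa>) (\<eta> x), Ident D b) (FObj Pt b, \<epsilon> b, b))"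

private lemma sys_unit_simp:
  "(x, \<kappa>, b) \<in> Obj (AfSys X D T) \<Longrightarrow> sys_unit (x, \<kappa>, b) =
     Arrow (x, \<kappa>, b) (Comp X (FArr Pt \<kappa>) (\<eta> x), Ident D b) (FObj Pt b, \<epsilon> b, b)"
  by (simp add: sys_unit_def)

private lemma sys_unit_hom:
  assumes P: "(x, \<kappa>, b) \<in> Obj (AfSys X D T)"
  shows "Arrow (x, \<kappa>, b) (Comp X (FArr Pt \<kappa>) (\<eta> x), Ident D b) (FObj Pt b, \<epsilon> b, b) \<in>
    hom (AfSys X D T) (x, \<kappa>, b) (FObj Pt b, \<epsilon> b, b)"
proof -
  have x: "x \<in> Obj X" and b: "b \<in> Obj D" and \<kappa>: "\<kappa> \<in> hom D (FObj T x) b"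
    using P by (simp_all add: AfSys_Obj)
  show ?thesis
    using P Comp_hom[OF X unit_hom[OF x] functor_hom[OF Pt \<kappa>]] Ident_hom[OF D b]
    by (simp add: AfSys_hom E_func_Obj_AfSys[OF b] counit_transpose[OF x \<kappa>] Comp_Ident_left[OF D \<kappa>])
qed

text \<open>
  At \<open>E b\<close> the unit has first component \<open>Pt \<epsilon>\<^sub>b \<circ> \<eta>\<close> (with \<open>\<eta>\<close> at \<open>Pt b\<close>), so this triangle identity
  reduces to one of the given adjunction; the other one composes identities of \<open>b\<close>. Naturality of
  the unit is that of \<open>\<eta>\<close> combined with the square of a system morphism.
\<close>

lemma adjoint_situation_Loc_E:
  "adjoint_situation (AfSys X D T) D (Loc_func X D T) (E_func D Pt \<epsilon>) sys_unit
    (\<lambda>b \<in> Obj D. Ident D b)"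
  and Loc_E: "func_comp D (Loc_func X D T) (E_func D Pt \<epsilon>) = id_func D"
proof -
  let ?A = "AfSys X D T" and ?L = "Loc_func X D T" and ?E = "E_func D Pt \<epsilon>"
  note A = category_AfSys[OF T] and L = functor_Loc_func[OF T] and E = functor_E_func
  show LE: "func_comp D ?L ?E = id_func D"
    by (rule functor_eqI[OF functor_func_comp[OF E L] functor_id_func[OF D]])
      (auto simp: E_func_Obj Loc_func_Obj E_func_Obj_AfSys E_func_hom[OF in_own_hom]
        Loc_func_hom[OF E_func_AfSys_hom[OF in_own_hom]])
  have unit: "nat_trans ?A ?A (id_func ?A) (func_comp ?A ?E ?L) sys_unit"
  proof (rule nat_transI[OF functor_id_func[OF A] functor_func_comp[OF L E]])
    show "sys_unit \<in> extensional (Obj ?A)"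
      by (simp add: sys_unit_def)
    show "sys_unit P \<in> hom ?A (FObj (id_func ?A) P) (FObj (func_comp ?A ?E ?L) P)"
      if "P \<in> Obj ?A" for P
      using that sys_unit_hom
      by (cases P) (auto simp: sys_unit_simp Loc_func_Obj E_func_Obj AfSys_Obj)
    show "Comp ?A (FArr (func_comp ?A ?E ?L) h) (sys_unit P) =
        Comp ?A (sys_unit Q) (FArr (id_func ?A) h)" if h: "h \<in> hom ?A P Q" for h P Q
      using h
    proof (cases rule: AfSys_homE)
      case (1 x1 \<kappa>1 b1 x2 \<kappa>2 b2 f \<phi>)
      have x: "x1 \<in> Obj X" "x2 \<in> Obj X" and b: "b1 \<in> Obj D" "b2 \<in> Obj D"
        and \<kappa>: "\<kappa>1 \<in> hom D (FObj T x1) b1" "\<kappa>2 \<in> hom D (FObj T x2) b2"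
        using 1(4,5) by (simp_all add: AfSys_Obj)
      note f = 1(6) and \<phi> = 1(7) and eq = 1(8)
      note Tf = functor_hom[OF T f]
      have "Comp X (FArr Pt \<phi>) (Comp X (FArr Pt \<kappa>1) (\<eta> x1)) =
          Comp X (FArr Pt (Comp D \<phi> \<kappa>1)) (\<eta> x1)"
        by (simp add: functor_Comp[OF Pt \<kappa>(1) \<phi>]
            Comp_assoc[OF X unit_hom[OF x(1)] functor_hom[OF Pt \<kappa>(1)] functor_hom[OF Pt \<phi>]])
      also have "\<dots> = Comp X (FArr Pt \<kappa>2) (Comp X (FArr Pt (FArr T f)) (\<eta> x1))"
        by (simp add: eq[symmetric] functor_Comp[OF Pt Tf \<kappa>(2)]
            Comp_assoc[OF X unit_hom[OF x(1)] functor_hom[OF Pt Tf] functor_hom[OF Pt \<kappa>(2)]])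
      also have "\<dots> = Comp X (Comp X (FArr Pt \<kappa>2) (\<eta> x2)) f"
        by (simp add: unit_natural[OF f]
            Comp_assoc[OF X f unit_hom[OF x(2)] functor_hom[OF Pt \<kappa>(2)]])
      finally show ?thesis
        using 1 h
        by (simp add: sys_unit_simp Loc_func_hom[OF h[unfolded 1(3)]] E_func_hom[OF \<phi>]
            AfSys_Comp[OF sys_unit_hom E_func_AfSys_hom] AfSys_Comp[OF _ sys_unit_hom]
            Comp_Ident_left[OF D \<phi>] Comp_Ident_right[OF D \<phi>])
    qed
  qed
  have counit: "nat_trans D D (func_comp D ?L ?E) (id_func D) (\<lambda>b \<in> Obj D. Ident D b)"
    using nat_trans_Ident[OF functor_id_func[OF D]] by (simp add: LE cong: restrict_cong)
  have "Comp D ((\<lambda>b \<in> Obj D. Ident D b) (FObj ?L P)) (FArr ?L (sys_unit P)) =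
      Ident D (FObj ?L P)" if P: "P \<in> Obj ?A" for P
  proof (cases P)
    case (fields x \<kappa> b)
    with P have b: "b \<in> Obj D" by (simp add: AfSys_Obj)
    show ?thesis
      using P b fields Comp_Ident_left[OF D Ident_hom[OF D b]]
      by (simp add: Loc_func_Obj sys_unit_simp Loc_func_hom[OF sys_unit_hom])
  qed
  moreover have "Comp ?A (FArr ?E ((\<lambda>b \<in> Obj D. Ident D b) b)) (sys_unit (FObj ?E b)) =
      Ident ?A (FObj ?E b)" if b: "b \<in> Obj D" for b
  proof -
    note P = E_func_Obj_AfSys[OF b]
    have "Comp X (FArr Pt (Ident D b)) (Comp X (FArr Pt (\<epsilon> b)) (\<eta> (FObj Pt b))) =
        Ident X (FObj Pt b)"
      using adjoint_situationD(6)[OF adj b] functor_Ident[OF Pt b]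
        Comp_Ident_left[OF X Ident_hom[OF X functor_Obj[OF Pt b]]] by simp
    then show ?thesis
      using b P Comp_Ident_left[OF D Ident_hom[OF D b]]
      by (simp add: E_func_Obj sys_unit_simp[OF P] E_func_hom[OF Ident_hom[OF D b]] AfSys_Ident
          AfSys_Comp[OF sys_unit_hom[OF P] E_func_AfSys_hom[OF Ident_hom[OF D b]]])
  qed
  ultimately show "adjoint_situation ?A D ?L ?E sys_unit (\<lambda>b \<in> Obj D. Ident D b)"
    using L E unit counit by (simp add: adjoint_situation_def)
qed

end

section \<open>Affine and localic affine institutions\<close>

theorem theorem8:
  fixes X :: "('xo, 'xa) cat"
    and \<Lambda> :: "'l set"
    and ar :: "'l \<Rightarrow> 'n set"
    and B :: "(('x, 'l, 'n) alg, (('x, 'l, 'n) alg, 'x \<Rightarrow> 'x) arrow) cat"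
    and T :: "('xo, 'xa, ('x, 'l, 'n) alg, (('x, 'l, 'n) alg, 'x \<Rightarrow> 'x) arrow) func"
    and Pt :: "(('x, 'l, 'n) alg, (('x, 'l, 'n) alg, 'x \<Rightarrow> 'x) arrow, 'xo, 'xa) func"
    and \<eta> :: "'xo \<Rightarrow> 'xa"
    and \<epsilon> :: "('x, 'l, 'n) alg \<Rightarrow> (('x, 'l, 'n) alg, 'x \<Rightarrow> 'x) arrow"
  assumes "category X"
    and "variety \<Lambda> ar B"
    and "is_functor X (op_cat B) T"
    and "adjoint_situation X (op_cat B) T Pt \<eta> \<epsilon>"
  shows
    "let Loc = Loc_func X (op_cat B) T;
         E = E_func (op_cat B) Pt \<epsilon>;
         AfI = AfInst X B T;
         LAfI = LAfInst B
     in
       (\<exists>ILoc.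
          is_functor AfI LAfI ILoc \<and>
          (\<forall>(S1 :: ('so, 'sa) cat) I1 (S2 :: ('so, 'sa) cat) I2 \<Phi> \<alpha>.
             Arrow (S1, I1) (\<Phi>, \<alpha>) (S2, I2) \<in> Arr AfI \<longrightarrow>
             FArr ILoc (Arrow (S1, I1) (\<Phi>, \<alpha>) (S2, I2)) =
               Arrow (S1, func_comp S1 Loc I1) (\<Phi>, whisker_left S1 Loc \<alpha>)
                     (S2, func_comp S2 Loc I2)) \<and>
          (\<exists>IE.
             full_embedding LAfI AfI IE \<and>
             (\<forall>S1 I1 S2 I2 \<Phi> \<alpha>.
                Arrow (S1, I1) (\<Phi>, \<alpha>) (S2, I2) \<in> Arr LAfI \<longrightarrow>
                FArr IE (Arrow (S1, I1) (\<Phi>, \<alpha>) (S2, I2)) =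
                  Arrow (S1, func_comp S1 E I1) (\<Phi>, whisker_left S1 E \<alpha>)
                        (S2, func_comp S2 E I2)) \<and>
             left_adjoint_left_inverse AfI LAfI ILoc IE)) \<and>
       (\<exists>R. full_reflective_subcategory R AfI \<and> isomorphic_cats LAfI R)"
proof -
  let ?D = "op_cat B"
  let ?L = "Loc_func X ?D T" and ?E = "E_func ?D Pt \<epsilon>"
  let ?AfI = "AfInst X B T :: ('so, 'sa, _, _) inst_cat"
    and ?LAfI = "LAfInst B :: ('so, 'sa, _, _) inst_cat"
  let ?IL = "Inst_func (AfSys X ?D T) ?L" and ?IE = "Inst_func ?D ?E"
  note adj = assms(4)
  note L = functor_Loc_func[OF assms(3)] and E = functor_E_func[OF adj]
  note D = functor_category(2)[OF assms(3)]
  have IL: "is_functor ?AfI ?LAfI ?IL"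
    unfolding AfInst_def LAfInst_def by (rule functor_Inst_func[OF L])
  have IE: "full_embedding ?LAfI ?AfI ?IE"
    unfolding AfInst_def LAfInst_def by (rule full_embedding_Inst_func[OF full_embedding_E_func[OF adj]])
  obtain \<eta>' \<epsilon>' where adj': "adjoint_situation ?AfI ?LAfI ?IL ?IE \<eta>' \<epsilon>'"
    unfolding AfInst_def LAfInst_def
    using adjoint_situation_Inst[OF adjoint_situation_Loc_E[OF adj]] by blast
  have inv: "func_comp ?LAfI ?IL ?IE = id_func ?LAfI"
    unfolding LAfInst_def
    by (simp add: Inst_func_comp[OF E L, symmetric] Loc_E[OF adj] Inst_func_id[OF D])
  have lali: "left_adjoint_left_inverse ?AfI ?LAfI ?IL ?IE"
    using adj' inv by (auto simp: left_adjoint_left_inverse_def)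
  have reflective: "\<exists>R. full_reflective_subcategory R ?AfI \<and> isomorphic_cats ?LAfI R"
    using full_reflective_image[OF IE adj'] isomorphic_full_sub_image[OF IE] by blast
  show ?thesis
    unfolding Let_def
  proof (intro conjI reflective exI[of _ ?IL] exI[of _ ?IE] IL IE lali allI impI)
    show "FArr ?IL (Arrow (S1, I1) (\<Phi>, \<alpha>) (S2, I2)) =
        Arrow (S1, func_comp S1 ?L I1) (\<Phi>, whisker_left S1 ?L \<alpha>) (S2, func_comp S2 ?L I2)"
      if "Arrow (S1, I1) (\<Phi>, \<alpha>) (S2, I2) \<in> Arr ?AfI" for S1 I1 S2 I2 \<Phi> \<alpha>
      using that unfolding AfInst_def by (rule Inst_func_Arr)
    show "FArr ?IE (Arrow (S1, I1) (\<Phi>, \<alpha>) (S2, I2)) =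
        Arrow (S1, func_comp S1 ?E I1) (\<Phi>, whisker_left S1 ?E \<alpha>) (S2, func_comp S2 ?E I2)"
      if "Arrow (S1, I1) (\<Phi>, \<alpha>) (S2, I2) \<in> Arr ?LAfI" for S1 I1 S2 I2 \<Phi> \<alpha>
      using that unfolding LAfInst_def by (rule Inst_func_Arr)
  qed
qed

end
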